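(* For $n\geq 8$, the numbers $a_n(123;231)$ satisfy \[ a_n(123;231) = a_{n-2}(123;231) + 2n-6 + \left\lceil \tfrac{n}{2}\right\rceil, \] where $a_6(123;231)=12$ and $a_7(123;231)=20$. In closed form, \[ a_n(123;231) = 5\binom{\lfloor (n-1)/2\rfloor}{2} + \begin{cases} 2n-5 & \text{if } n \text{ is even},\\ n-2 & \text{if } n \text{ is odd}.\end{cases} \]
   Context: $\mathcal{S}_n$ is the set of permutations of $[n]=\{1,\dots,n\}$, written in one-line notation $\pi=\pi_1\pi_2\cdots\pi_n$ with $\pi_i=\pi(i)$. A permutation is cyclic if it consists of exactly one $n$-cycle. For a cyclic $\pi$, its standard cycle notation is $C(\pi)=(c_1,c_2,\dots,c_n)$ with $c_1=1$ and $c_i=\pi_{c_{i-1}}$ for $2\le i\le n$. A sequence of distinct integers $w_1\cdots w_m$ contains a pattern $\sigma\in\mathcal{S}_k$ if there are indices $i_1<\dots<i_k$ with $w_{i_1}\cdots w_{i_k}$ in the same relative order as $\sigma_1\cdots\sigma_k$; otherwise it avoids $\sigma$. For $\sigma,\tau\in\mathcal{S}_3$, $\mathcal{A}_n(\sigma;\tau)$ is the set of cyclic permutations $\pi\in\mathcal{S}_n$ whose one-line notation avoids $\sigma$ and whose cycle notation $C(\pi)$ (as the sequence $c_1c_2\cdots c_n$) avoids $\tau$; $a_n(\sigma;\tau)=|\mathcal{A}_n(\sigma;\tau)|$. *)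

theory Defs
  imports Complex_Main "HOL-Combinatorics.Permutations" "HOL-Combinatorics.Orbits"
begin

text \<open>Finite sequences, and patterns in one-line notation, are lists of naturals; positions in a
  list are counted from 0, so \<open>w ! (i - 1)\<close> is the entry \<open>w\<^sub>i\<close> of the usual notation.\<close>

definition contains_pattern :: "nat list \<Rightarrow> nat list \<Rightarrow> bool" where
  "contains_pattern w \<sigma> \<longleftrightarrow>
     (\<exists>f. strict_mono_on {..<length \<sigma>} f \<and> f ` {..<length \<sigma>} \<subseteq> {..<length w} \<and>
          (\<forall>i<length \<sigma>. \<forall>j<length \<sigma>. w ! f i < w ! f j \<longleftrightarrow> \<sigma> ! i < \<sigma> ! j))"

abbreviation avoids_pattern :: "nat list \<Rightarrow> nat list \<Rightarrow> bool" where
  "avoids_pattern w \<sigma> \<equiv> \<not> contains_pattern w \<sigma>"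

text \<open>A permutation of \<open>{1..n}\<close> is a function on \<open>nat\<close> that is the identity outside \<open>{1..n}\<close>, so
  that counting functions is counting permutations. The whole set \<open>{1..n}\<close> being one orbit means
  that the permutation is a single \<open>n\<close>-cycle; the identity of \<open>{1}\<close> counts as a 1-cycle.\<close>

definition cyclic_perms :: "nat \<Rightarrow> (nat \<Rightarrow> nat) set" where
  "cyclic_perms n = {\<pi>. \<pi> permutes {1..n} \<and> cyclic_on \<pi> {1..n}}"

definition one_line :: "nat \<Rightarrow> (nat \<Rightarrow> nat) \<Rightarrow> nat list" where
  "one_line n \<pi> = map \<pi> [1..<Suc n]"

text \<open>The recursion \<open>c\<^sub>1 = 1\<close>, \<open>c\<^sub>i = \<pi> c\<^sub>i\<^sub>-\<^sub>1\<close> unfolds to \<open>c\<^sub>i = (\<pi> ^^ (i - 1)) 1\<close>.\<close>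

definition cycle_notation :: "nat \<Rightarrow> (nat \<Rightarrow> nat) \<Rightarrow> nat list" where
  "cycle_notation n \<pi> = map (\<lambda>i. (\<pi> ^^ i) 1) [0..<n]"

definition cyclic_avoiders :: "nat \<Rightarrow> nat list \<Rightarrow> nat list \<Rightarrow> (nat \<Rightarrow> nat) set" where
  "cyclic_avoiders n \<sigma> \<tau> =
     {\<pi> \<in> cyclic_perms n. avoids_pattern (one_line n \<pi>) \<sigma> \<and>
                          avoids_pattern (cycle_notation n \<pi>) \<tau>}"

definition num_cyclic_avoiders :: "nat \<Rightarrow> nat list \<Rightarrow> nat list \<Rightarrow> nat" where
  "num_cyclic_avoiders n \<sigma> \<tau> = card (cyclic_avoiders n \<sigma> \<tau>)"

end

(* Write the cycle as a word w starting with 1; avoiding 231 means that everything before a maximum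
   is smaller than everything after it, so w splits into blocks of consecutive values. Avoiding 123
   makes the permutation decreasing on each block apart from the entry where the cycle leaves the
   block, and a decreasing map traverses an interval in the zigzag order a, b, a + 1, b - 1, ...
   Hence a word is determined by its block boundaries, up to a bounded number of sporadic words.
   For n >= 8 there are n - 3 words in which n is neither second nor last, n - 3 words 1 n k ...
   with k > 2, and ceiling (n / 2) words ending in n; removing 1 and n from the words 1 n 2 ...
   gives those of length n - 2. The words ending in n are counted by the same removal, now of 1 and
   n - 1. *)

theory Submission
  imports Defs "HOL-Library.Sublist"
begin

text \<open>Decrease on a block is always obtained in the same way: an ascent of \<open>f\<close>
  inside the block is completed to an increasing triple by one fixed arrow, from a smaller argument
  to a value below the ascent or from a larger argument to a value above it. A chain carries a block
  without its last entry onto the block without its first. If the first entry is an end of the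
  block, this image is an interval, and a decreasing map onto an interval is fixed by ranks. The
  obstacle is a block that starts with neither of its ends. With minimum 2, left upwards and entered
  from above, it can only be 3 2 4 or 3 2 5 4. This explains the bound 8: in a word ending in n such
  a block would have maximum n - 2, which needs n = 6 or n = 7. These two lengths are enumerated and
  serve as base cases. For n >= 8 one trace of such blocks survives, the word 1 n 3 2 4 (n - 1) ...
  with a zigzag behind it.\<close>

section \<open>Patterns of length three as subsequences\<close>

lemma contains_pattern_3_iff:
  "contains_pattern w [a, b, c] \<longleftrightarrow>
     (\<exists>i j k. i < j \<and> j < k \<and> k < length w \<and>
        (w ! i < w ! j \<longleftrightarrow> a < b) \<and> (w ! j < w ! i \<longleftrightarrow> b < a) \<and>
        (w ! i < w ! k \<longleftrightarrow> a < c) \<and> (w ! k < w ! i \<longleftrightarrow> c < a) \<and>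
        (w ! j < w ! k \<longleftrightarrow> b < c) \<and> (w ! k < w ! j \<longleftrightarrow> c < b))"
    (is "?L \<longleftrightarrow> ?R")
proof
  assume ?L
  then obtain f where f: "strict_mono_on {..<3::nat} f" "f ` {..<3} \<subseteq> {..<length w}"
      "\<forall>i<3. \<forall>j<3. w ! f i < w ! f j \<longleftrightarrow> [a, b, c] ! i < [a, b, c] ! j"
    unfolding contains_pattern_def by (auto simp: eval_nat_numeral)
  have "f 0 < f 1" "f 1 < f 2"
    using f(1) by (auto simp: strict_mono_on_def)
  moreover have "f 2 < length w"
    using f(2) by (simp add: image_subset_iff)
  moreover have "w ! f i < w ! f j \<longleftrightarrow> [a, b, c] ! i < [a, b, c] ! j" if "i < 3" "j < 3" for i j
    using f(3) that by blast
  from this[of 0 1] this[of 1 0] this[of 0 2] this[of 2 0] this[of 1 2] this[of 2 1]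
  have "(w ! f 0 < w ! f 1 \<longleftrightarrow> a < b) \<and> (w ! f 1 < w ! f 0 \<longleftrightarrow> b < a) \<and>
        (w ! f 0 < w ! f 2 \<longleftrightarrow> a < c) \<and> (w ! f 2 < w ! f 0 \<longleftrightarrow> c < a) \<and>
        (w ! f 1 < w ! f 2 \<longleftrightarrow> b < c) \<and> (w ! f 2 < w ! f 1 \<longleftrightarrow> c < b)"
    by (simp add: eval_nat_numeral)
  ultimately show ?R by blast
next
  assume ?R
  then obtain i j k where *: "i < j" "j < k" "k < length w"
      "(w ! i < w ! j \<longleftrightarrow> a < b)" "(w ! j < w ! i \<longleftrightarrow> b < a)"
      "(w ! i < w ! k \<longleftrightarrow> a < c)" "(w ! k < w ! i \<longleftrightarrow> c < a)"
      "(w ! j < w ! k \<longleftrightarrow> b < c)" "(w ! k < w ! j \<longleftrightarrow> c < b)" by blast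
  have three: "{..<length [a, b, c]} = {0, 1, 2}" by auto
  have "strict_mono_on {..<length [a, b, c]} (\<lambda>t. [i, j, k] ! t)"
    unfolding three using * by (auto simp: strict_mono_on_def)
  moreover have "(\<lambda>t. [i, j, k] ! t) ` {..<length [a, b, c]} \<subseteq> {..<length w}"
    unfolding three using * by auto
  moreover have "\<forall>p\<in>{..<length [a, b, c]}. \<forall>q\<in>{..<length [a, b, c]}.
      w ! ([i, j, k] ! p) < w ! ([i, j, k] ! q) \<longleftrightarrow> [a, b, c] ! p < [a, b, c] ! q"
    unfolding three using * by auto
  ultimately show ?L unfolding contains_pattern_def Ball_def lessThan_iff by blast
qed

lemma subseq_Cons_iff_drop:
  "subseq (x # xs) w \<longleftrightarrow> (\<exists>i<length w. w ! i = x \<and> subseq xs (drop (Suc i) w))"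
proof
  assume "subseq (x # xs) w"
  then obtain us vs where "w = us @ x # vs" "subseq xs vs"
    by (auto dest: list_emb_ConsD)
  then show "\<exists>i<length w. w ! i = x \<and> subseq xs (drop (Suc i) w)"
    by (intro exI[of _ "length us"]) auto
next
  assume "\<exists>i<length w. w ! i = x \<and> subseq xs (drop (Suc i) w)"
  then obtain i where i: "i < length w" "w ! i = x" "subseq xs (drop (Suc i) w)" by blast
  then have "subseq (x # xs) (drop i w)" by (simp flip: Cons_nth_drop_Suc)
  then show "subseq (x # xs) w" by (metis append_take_drop_id subseq_drop_many)
qed

text \<open>Phrased with \<open>subseq\<close> instead of positions, so that passing to subwords and
  cutting a word in two are instances of general facts about \<open>subseq\<close>.\<close>

definition avoids_231 :: "nat list \<Rightarrow> bool" where
  "avoids_231 w \<longleftrightarrow> (\<forall>x y z. subseq [x, y, z] w \<longrightarrow> z < x \<longrightarrow> \<not> x < y)"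

definition avoids_123 :: "nat \<Rightarrow> (nat \<Rightarrow> nat) \<Rightarrow> bool" where
  "avoids_123 n f \<longleftrightarrow> (\<forall>i j k. 1 \<le> i \<longrightarrow> i < j \<longrightarrow> j < k \<longrightarrow> k \<le> n \<longrightarrow> f i < f j \<longrightarrow> \<not> f j < f k)"

lemma subseq_3_iff:
  "subseq [x, y, z] w \<longleftrightarrow> (\<exists>i j k. i < j \<and> j < k \<and> k < length w \<and> x = w ! i \<and> y = w ! j \<and> z = w ! k)"
    (is "?L \<longleftrightarrow> ?R")
proof
  assume ?L
  then obtain i j k where "i < length w" "w ! i = x" "j < length w - Suc i" "drop (Suc i) w ! j = y"
     "k < length w - Suc i - Suc j" "drop (Suc j) (drop (Suc i) w) ! k = z"
    by (auto simp: subseq_Cons_iff_drop simp del: drop_drop)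
  then show ?R by (intro exI[of _ i] exI[of _ "Suc i + j"] exI[of _ "Suc i + Suc j + k"]) (auto simp: add_ac)
next
  assume ?R
  then obtain i j k where *: "i < j" "j < k" "k < length w" "x = w ! i" "y = w ! j" "z = w ! k" by blast
  have "subseq [z] (drop (Suc j) w)"
    unfolding subseq_Cons_iff_drop using * by (intro exI[of _ "k - Suc j"]) auto
  then have "subseq [y, z] (drop (Suc i) w)"
    unfolding subseq_Cons_iff_drop[of y] using * by (intro exI[of _ "j - Suc i"]) auto
  then show ?L unfolding subseq_Cons_iff_drop[of x] using * by (intro exI[of _ i]) auto
qed

lemma avoids_pattern_231: "avoids_pattern w [2, 3, 1] \<longleftrightarrow> avoids_231 w"
proof -
  have "contains_pattern w [2, 3, 1] \<longleftrightarrow>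
      (\<exists>i j k. i < j \<and> j < k \<and> k < length w \<and> w ! k < w ! i \<and> w ! i < w ! j)"
    unfolding contains_pattern_3_iff by (intro ex_cong1) auto
  then show ?thesis unfolding avoids_231_def subseq_3_iff by blast
qed

lemma contains_123_iff:
  "contains_pattern w [1, 2, 3] \<longleftrightarrow>
     (\<exists>i j k. i < j \<and> j < k \<and> k < length w \<and> w ! i < w ! j \<and> w ! j < w ! k)"
  unfolding contains_pattern_3_iff by (intro ex_cong1) auto

lemma avoids_pattern_123: "avoids_pattern (one_line n f) [1, 2, 3] \<longleftrightarrow> avoids_123 n f"
proof -
  have "(\<exists>i j k. i < j \<and> j < k \<and> k < n \<and> f (Suc i) < f (Suc j) \<and> f (Suc j) < f (Suc k)) \<longleftrightarrow>
        \<not> avoids_123 n f" (is "?L \<longleftrightarrow> ?R")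
  proof
    assume ?L
    then obtain i j k where "i < j" "j < k" "k < n" "f (Suc i) < f (Suc j)" "f (Suc j) < f (Suc k)"
      by blast
    then show ?R unfolding avoids_123_def
      by (metis Suc_le_eq Suc_mono le_add1 plus_1_eq_Suc)
  next
    assume ?R
    then obtain i j k where "1 \<le> i" "i < j" "j < k" "k \<le> n" "f i < f j" "f j < f k"
      unfolding avoids_123_def by blast
    then show ?L by (intro exI[of _ "i - 1"] exI[of _ "j - 1"] exI[of _ "k - 1"]) auto
  qed
  moreover have "one_line n f ! i = f (Suc i)" if "i < n" for i
    using that unfolding one_line_def by (simp del: upt_Suc)
  moreover have "length (one_line n f) = n" by (simp add: one_line_def)
  ultimately show ?thesis unfolding contains_123_iff by (smt (verit, ccfv_SIG) less_trans)
qed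

section \<open>Cycles as words\<close>

abbreviation chain :: "(nat \<Rightarrow> nat) \<Rightarrow> nat list \<Rightarrow> bool" where
  "chain f \<equiv> successively (\<lambda>x y. f x = y)"

definition cycle_word :: "nat \<Rightarrow> (nat \<Rightarrow> nat) \<Rightarrow> nat list \<Rightarrow> bool" where
  "cycle_word n f w \<longleftrightarrow> distinct w \<and> set w = {1..n} \<and> hd w = 1 \<and> chain f w \<and> f (last w) = 1"

text \<open>The word determines \<open>f\<close> on \<open>{1..n}\<close>
  (\<open>cycle_word_agree\<close>), so the existential quantifier hides no choice that matters, and
  counting words is counting permutations.\<close>

definition good_words :: "nat \<Rightarrow> nat list set" where
  "good_words n = {w. avoids_231 w \<and> (\<exists>f. cycle_word n f w \<and> avoids_123 n f)}"

text \<open>The first return time \<open>funpow_dist1 f s s\<close> enumerates the orbit without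
  repetition, hence equals its size.\<close>

lemma cyclic_on_funpow_card:
  assumes "cyclic_on f S" "s \<in> S"
  shows "(f ^^ card S) s = s" "inj_on (\<lambda>i. (f ^^ i) s) {0..<card S}"
        "(\<lambda>i. (f ^^ i) s) ` {0..<card S} = S"
proof -
  have S: "orbit f s = S" by (rule orbit_cyclic_eq3[OF assms])
  then have self: "s \<in> orbit f s" using assms(2) by simp
  note inj = inj_on_funpow_dist1[OF self] and im = orbit_conv_funpow_dist1[OF self]
  have c: "card S = funpow_dist1 f s s"
    using card_image[OF inj] im S by simp
  show "(f ^^ card S) s = s" using funpow_dist1_prop[OF self] c by simp
  show "inj_on (\<lambda>i. (f ^^ i) s) {0..<card S}" using inj c by simp
  show "(\<lambda>i. (f ^^ i) s) ` {0..<card S} = S" using im c S by simp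
qed

lemma cycle_word_cycle_notation:
  assumes "p \<in> cyclic_perms n" "1 \<le> n"
  shows "cycle_word n p (cycle_notation n p)"
proof -
  have "cyclic_on p {1..n}" "1 \<in> {1..n}" using assms by (auto simp: cyclic_perms_def)
  note c = cyclic_on_funpow_card[OF this, simplified]
  have "cycle_notation n p \<noteq> []" using assms(2) by (simp add: cycle_notation_def)
  then have "p (last (cycle_notation n p)) = (p ^^ n) 1"
    using assms(2) by (cases n) (simp_all add: cycle_notation_def)
  moreover have "chain p (cycle_notation n p)"
    by (auto simp: successively_conv_nth cycle_notation_def)
  ultimately show ?thesis using c assms(2)
    by (auto simp: cycle_word_def cycle_notation_def distinct_map hd_map)
qed

lemma cycle_word_nth:
  assumes "cycle_word n f w" "i < n"
  shows "w ! i = (f ^^ i) 1"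
  using assms(2)
proof (induction i)
  case 0
  then show ?case using assms(1) by (cases w) (auto simp: cycle_word_def)
next
  case (Suc i)
  have "length w = n" using assms(1) distinct_card[of w] by (auto simp: cycle_word_def)
  then show ?case using Suc assms(1) by (auto simp: cycle_word_def successively_conv_nth)
qed

lemma cycle_word_eq_cycle_notation:
  assumes "cycle_word n f w"
  shows "w = cycle_notation n f"
proof -
  have "length w = n" using assms distinct_card[of w] by (auto simp: cycle_word_def)
  then show ?thesis using cycle_word_nth[OF assms]
    by (intro nth_equalityI) (auto simp: cycle_notation_def)
qed

lemma cycle_word_funpow:
  assumes "cycle_word n f w" "1 \<le> n"
  shows "(f ^^ n) 1 = 1"
proof -
  have l: "length w = n" "w \<noteq> []" using assms distinct_card[of w] by (auto simp: cycle_word_def)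
  then have "last w = (f ^^ (n - 1)) 1"
    using cycle_word_nth[OF assms(1), of "n - 1"] assms(2) by (simp add: last_conv_nth)
  moreover have "(f ^^ n) 1 = f ((f ^^ (n - 1)) 1)"
    using assms(2) by (metis comp_apply funpow.simps(2) le_add_diff_inverse plus_1_eq_Suc)
  ultimately show ?thesis using assms(1) by (simp add: cycle_word_def)
qed

lemma cycle_word_cong:
  assumes "cycle_word n f w" "\<And>x. x \<in> {1..n} \<Longrightarrow> g x = f x" "1 \<le> n"
  shows "cycle_word n g w"
proof -
  have "w \<noteq> []" using assms by (auto simp: cycle_word_def)
  then have "last w \<in> {1..n}" using assms(1) last_in_set[of w] by (auto simp: cycle_word_def)
  moreover have "chain g w = chain f w"
    using assms(1,2) by (intro successively_cong) (auto simp: cycle_word_def)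
  ultimately show ?thesis using assms(1,2) by (auto simp: cycle_word_def)
qed

lemma cycle_word_perm:
  assumes "cycle_word n f w" "\<And>x. x \<notin> {1..n} \<Longrightarrow> f x = x" "1 \<le> n"
  shows "f \<in> cyclic_perms n"
proof -
  have w: "w = cycle_notation n f" "set w = {1..n}"
    using cycle_word_eq_cycle_notation assms(1) by (auto simp: cycle_word_def)
  have orb: "orbit f 1 = {(f ^^ m) 1 |m. m < n}"
    by (intro orbit_altdef_bounded cycle_word_funpow[OF assms(1)]) (use assms(3) in auto)
  also have "\<dots> = set w" by (auto simp: w(1) cycle_notation_def)
  finally have orb: "orbit f 1 = {1..n}" using w(2) by simp
  then have cyc: "cyclic_on f {1..n}" using assms(3) by (intro cyclic_on_singleI[of 1]) auto
  \<comment> \<open>By its inductive definition every orbit element is an image of 1 or of an orbit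
    element; surjectivity on a finite set then gives bijectivity.\<close>
  have "{1..n} \<subseteq> f ` {1..n}"
  proof
    fix y assume "y \<in> {1..n}"
    then have "y \<in> orbit f 1" using orb by simp
    then show "y \<in> f ` {1..n}" by cases (use orb assms(3) in auto)
  qed
  then have "bij_betw f {1..n} {1..n}"
    using cyclic_on_inI[OF cyc] by (intro bij_betw_imageI finite_surj_inj) auto
  then have "f permutes {1..n}" using assms(2) by (intro bij_imp_permutes)
  then show ?thesis using cyc by (simp add: cyclic_perms_def)
qed

lemma cycle_word_agree:
  assumes f: "cycle_word n f w" and g: "cycle_word n g w" and x: "x \<in> {1..n}"
  shows "f x = g x"
proof -
  have "x \<in> set w" using f x by (simp add: cycle_word_def)
  then obtain i where i: "i < length w" "x = w ! i" by (metis in_set_conv_nth)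
  show ?thesis
  proof (cases "Suc i < length w")
    case True
    then show ?thesis using f g i by (simp add: cycle_word_def successively_conv_nth)
  next
    case False
    then have "x = last w" using i by (metis Suc_lessI diff_Suc_1 last_conv_nth length_0_conv not_less_zero)
    then show ?thesis using f g by (simp add: cycle_word_def)
  qed
qed

lemma avoids_123_cong:
  assumes "\<And>x. x \<in> {1..n} \<Longrightarrow> g x = f x"
  shows "avoids_123 n g = avoids_123 n f"
  unfolding avoids_123_def using assms
  by (smt (verit) atLeastAtMost_iff less_imp_le_nat order.trans)

lemma card_cyclic_avoiders:
  assumes "1 \<le> n"
  shows "num_cyclic_avoiders n [1, 2, 3] [2, 3, 1] = card (good_words n)"
proof -
  have "inj_on (cycle_notation n) (cyclic_perms n)"
  proof (rule inj_onI)
    fix p q assume p: "p \<in> cyclic_perms n" and q: "q \<in> cyclic_perms n"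
      and eq: "cycle_notation n p = cycle_notation n q"
    note cw = cycle_word_cycle_notation[OF p assms] cycle_word_cycle_notation[OF q assms]
    show "p = q"
    proof
      fix x show "p x = q x"
      proof (cases "x \<in> {1..n}")
        case True
        then show ?thesis using cycle_word_agree cw eq by metis
      next
        case False
        then show ?thesis using p q by (auto simp: cyclic_perms_def permutes_def)
      qed
    qed
  qed
  then have inj: "inj_on (cycle_notation n) (cyclic_avoiders n [1, 2, 3] [2, 3, 1])"
    by (rule inj_on_subset) (auto simp: cyclic_avoiders_def)
  have "cycle_notation n ` cyclic_avoiders n [1, 2, 3] [2, 3, 1] = good_words n"
  proof (intro equalityI subsetI)
    fix w assume "w \<in> cycle_notation n ` cyclic_avoiders n [1, 2, 3] [2, 3, 1]"
    then show "w \<in> good_words n" using cycle_word_cycle_notation assms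
      by (auto simp: cyclic_avoiders_def good_words_def avoids_pattern_123 avoids_pattern_231
          simp del: One_nat_def)
  next
    fix w assume "w \<in> good_words n"
    then obtain f where f: "avoids_231 w" "cycle_word n f w" "avoids_123 n f"
      by (auto simp: good_words_def)
    \<comment> \<open>The witness \<open>f\<close> is arbitrary outside \<open>{1..n}\<close>,
      whereas a permutation has to be the identity there.\<close>
    define p where "p x = (if x \<in> {1..n} then f x else x)" for x
    have p: "cycle_word n p w" "avoids_123 n p"
      using cycle_word_cong[OF f(2), of p] f(3) avoids_123_cong[of n p f] assms
      by (auto simp: p_def)
    moreover have "p \<in> cyclic_perms n"
      using p(1) assms by (intro cycle_word_perm) (auto simp: p_def)
    ultimately have "p \<in> cyclic_avoiders n [1, 2, 3] [2, 3, 1]"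
      using f(1) cycle_word_eq_cycle_notation[OF p(1)]
      by (simp add: cyclic_avoiders_def avoids_pattern_123 avoids_pattern_231 del: One_nat_def)
    then show "w \<in> cycle_notation n ` cyclic_avoiders n [1, 2, 3] [2, 3, 1]"
      using cycle_word_eq_cycle_notation[OF p(1)] by blast
  qed
  then show ?thesis
    unfolding num_cyclic_avoiders_def using card_image[OF inj] by simp
qed

section \<open>Words avoiding 231\<close>

lemma avoids_231_subseq: "avoids_231 w \<Longrightarrow> subseq u w \<Longrightarrow> avoids_231 u"
  unfolding avoids_231_def using subseq_order.order_trans by blast

lemma subseq_set: "subseq u w \<Longrightarrow> set u \<subseteq> set w"
  by (metis notin_set_nthsI subseq_conv_nths subsetI)

lemma avoids_231_short [simp]: "avoids_231 []" "avoids_231 [x]" "avoids_231 [x, y]"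
  by (auto simp: avoids_231_def)

text \<open>A new first entry can only play the 2 of a pattern 231, and this needs a smaller entry
  later.\<close>

lemma avoids_231_Cons_min:
  assumes "\<forall>y\<in>set w. x \<le> y"
  shows "avoids_231 (x # w) \<longleftrightarrow> avoids_231 w"
proof
  assume w: "avoids_231 w"
  show "avoids_231 (x # w)"
    unfolding avoids_231_def
  proof (intro allI impI notI)
    fix p q r assume *: "subseq [p, q, r] (x # w)" "r < p" "p < q"
    then have r: "r \<in> set (x # w)" using subseq_set[OF *(1)] by auto
    have "p \<noteq> x" using *(2) r assms by auto
    then have "subseq [p, q, r] w" using *(1) by (simp split: if_splits)
    then show False using w * by (auto simp: avoids_231_def)
  qed
qed (auto elim: avoids_231_subseq)

text \<open>Here the new first entry lacks a larger entry that could play the 3.\<close>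

lemma avoids_231_Cons_max:
  assumes "\<forall>y\<in>set w. y \<le> x"
  shows "avoids_231 (x # w) \<longleftrightarrow> avoids_231 w"
proof
  assume w: "avoids_231 w"
  show "avoids_231 (x # w)"
    unfolding avoids_231_def
  proof (intro allI impI notI)
    fix p q r assume *: "subseq [p, q, r] (x # w)" "r < p" "p < q"
    then have q: "q \<in> set (x # w)" using subseq_set[OF *(1)] by auto
    have "p \<noteq> x" using *(3) q assms by auto
    then have "subseq [p, q, r] w" using *(1) by (simp split: if_splits)
    then show False using w * by (auto simp: avoids_231_def)
  qed
qed (auto elim: avoids_231_subseq)

text \<open>The first entry of a pattern 231 exceeds its last one, so no occurrence straddles the
  cut.\<close>

lemma avoids_231_append:
  assumes "avoids_231 u" "avoids_231 v" "\<forall>x\<in>set u. \<forall>y\<in>set v. x < y"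
  shows "avoids_231 (u @ v)"
  unfolding avoids_231_def
proof (intro allI impI notI)
  fix p q r assume *: "subseq [p, q, r] (u @ v)" "r < p" "p < q"
  then obtain s t where st: "[p, q, r] = s @ t" "subseq s u" "subseq t v"
    by (auto simp: subseq_append_iff)
  consider "t = []" | "s = []" | "p \<in> set s" "r \<in> set t"
    using st(1) by (cases s; cases t rule: rev_cases) auto
  then show False
  proof cases
    case 1
    then show ?thesis using st assms(1) * by (auto simp: avoids_231_def)
  next
    case 2
    then show ?thesis using st assms(2) * by (auto simp: avoids_231_def)
  next
    case 3
    then have "p < r" using st(2,3) assms(3) subseq_set by blast
    then show ?thesis using *(2) by simp
  qed
qed

lemma avoids_231_appendD:
  assumes "avoids_231 (u @ v)"
  shows "avoids_231 u" "avoids_231 v"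
  using assms by (auto elim!: avoids_231_subseq intro: subseq_drop_many subseq_rev_drop_many)

lemma avoids_231_ConsD: "avoids_231 (x # v) \<Longrightarrow> avoids_231 v"
  using avoids_231_appendD(2)[of "[x]" v] by simp

lemma avoids_231_max_split:
  assumes "avoids_231 (u @ M # v)" "\<forall>x\<in>set u. x < M" "x \<in> set u" "y \<in> set v"
  shows "x \<le> y"
proof (rule ccontr)
  assume "\<not> x \<le> y"
  moreover have "subseq ([x] @ [M] @ [y]) (u @ [M] @ v)"
    using assms(3,4) by (intro list_emb_append_mono) (auto simp: subseq_singleton_left)
  ultimately show False using assms by (auto simp: avoids_231_def)
qed

lemma avoids_231_hd_split:
  assumes "avoids_231 (x # w)" "x \<notin> set w"
  obtains u v where "w = u @ v" "\<forall>y\<in>set u. y < x" "\<forall>y\<in>set v. x < y"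
proof
  let ?u = "takeWhile (\<lambda>y. y < x) w" and ?v = "dropWhile (\<lambda>y. y < x) w"
  show "w = ?u @ ?v" by simp
  show "\<forall>y\<in>set ?u. y < x" by (auto dest: set_takeWhileD)
  show "\<forall>y\<in>set ?v. x < y"
  proof (cases ?v)
    case (Cons z zs)
    then have "\<not> z < x" by (metis dropWhile_eq_Cons_conv)
    moreover have "z \<in> set w" by (metis Cons list.set_intros(1) set_dropWhileD)
    ultimately have z: "x < z" using assms(2) by (metis linorder_neqE_nat)
    have "x < y" if "y \<in> set zs" for y
    proof (rule ccontr)
      assume "\<not> x < y"
      have "y \<in> set w" by (metis Cons list.set_intros(2) set_dropWhileD that)
      then have "y < x" using \<open>\<not> x < y\<close> assms(2) by (metis linorder_neqE_nat)
      have "subseq ([z] @ [y]) ([z] @ zs)"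
        using that by (intro list_emb_append_mono) (auto simp: subseq_singleton_left)
      then have "subseq [z, y] ?v" using Cons by simp
      then have "subseq [z, y] w" by (metis subseq_drop_many takeWhile_dropWhile_id)
      then have "subseq [x, z, y] (x # w)" by simp
      then show False using assms(1) z \<open>y < x\<close> by (auto simp: avoids_231_def)
    qed
    then show ?thesis using Cons z by auto
  next
    case Nil
    then show ?thesis unfolding Nil by simp
  qed
qed

text \<open>Turns the order separation forced by avoiding 231 into a numerical block boundary
  \<open>j\<close>.\<close>

lemma interval_split:
  fixes a b :: nat
  assumes "A \<union> B = {a..b}" "\<forall>x\<in>A. \<forall>y\<in>B. x < y" "A \<noteq> {}"
  obtains j where "j \<in> A" "A = {a..j}" "B = {Suc j..b}"
proof
  have fin: "finite A" by (metis assms(1) finite_Un finite_atLeastAtMost)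
  let ?j = "Max A"
  show j: "?j \<in> A" using fin assms(3) by simp
  have le: "x \<le> ?j" if "x \<in> A" for x using fin that by simp
  have gt: "?j < y" if "y \<in> B" for y using j that assms(2) by blast
  have mem: "x \<in> A \<or> x \<in> B \<longleftrightarrow> a \<le> x \<and> x \<le> b" for x
    using assms(1) by (metis Un_iff atLeastAtMost_iff)
  show "A = {a..?j}"
  proof (intro set_eqI iffI)
    fix x assume "x \<in> A" then show "x \<in> {a..?j}" using le mem[of x] by auto
  next
    fix x assume "x \<in> {a..?j}" then show "x \<in> A" using mem[of x] gt[of x] mem[of ?j] j by auto
  qed
  show "B = {Suc ?j..b}"
  proof (intro set_eqI iffI)
    fix x assume "x \<in> B" then show "x \<in> {Suc ?j..b}" using gt[of x] mem[of x] by auto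
  next
    fix x assume "x \<in> {Suc ?j..b}" then show "x \<in> B" using mem[of x] le[of x] mem[of ?j] j by auto
  qed
qed

section \<open>Zigzag words and decreasing maps\<close>

function zigzag :: "nat \<Rightarrow> nat \<Rightarrow> nat list" where
  "zigzag a b = (if b < a then [] else if a = b then [a] else a # b # zigzag (Suc a) (b - 1))"
  by auto
termination by (relation "measure (\<lambda>(a, b). Suc b - a)") auto

declare zigzag.simps [simp del]

lemma zigzag_Nil [simp]: "b < a \<Longrightarrow> zigzag a b = []"
  and zigzag_singleton [simp]: "zigzag a a = [a]"
  and zigzag_Cons: "a < b \<Longrightarrow> zigzag a b = a # b # zigzag (Suc a) (b - 1)"
  by (simp_all add: zigzag.simps)

lemma zigzag_eq_Nil_iff [simp]: "zigzag a b = [] \<longleftrightarrow> b < a"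
  by (simp add: zigzag.simps)

lemma hd_zigzag [simp]: "a \<le> b \<Longrightarrow> hd (zigzag a b) = a"
  by (simp add: zigzag.simps)

lemma set_zigzag [simp]: "set (zigzag a b) = {a..b}"
proof (induction a b rule: zigzag.induct)
  case (1 a b)
  consider "b < a" | "a = b" | "a < b" by linarith
  then show ?case
    by cases (use 1 in \<open>auto simp: zigzag_Cons\<close>)
qed

lemma distinct_zigzag [simp]: "distinct (zigzag a b)"
proof (induction a b rule: zigzag.induct)
  case (1 a b)
  consider "b < a" | "a = b" | "a < b" by linarith
  then show ?case
    by cases (use 1 in \<open>auto simp: zigzag_Cons\<close>)
qed

lemma avoids_231_zigzag [simp]: "avoids_231 (zigzag a b)"
proof (induction a b rule: zigzag.induct)
  case (1 a b)
  consider "b < a" | "a = b" | "a < b" by linarith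
  then show ?case
  proof cases
    case 3
    have "\<forall>y\<in>set (zigzag (Suc a) (b - 1)). y \<le> b" "\<forall>y\<in>set (b # zigzag (Suc a) (b - 1)). a \<le> y"
      using 3 by auto
    then show ?thesis using 3 1
      by (simp add: zigzag_Cons avoids_231_Cons_min avoids_231_Cons_max del: set_zigzag)
  qed auto
qed

text \<open>The interval shrinks by one at both ends, so the word stops at its centre, at the upper
  middle entry when the length is even.\<close>

lemma last_zigzag: "a \<le> b \<Longrightarrow> last (zigzag a b) = (a + b + 1) div 2"
proof (induction a b rule: zigzag.induct)
  case (1 a b)
  consider "a = b" | "b = Suc a" | "Suc a < b" using "1.prems" by linarith
  then show ?case
  proof cases
    case 3
    then show ?thesis using "1.IH" by (simp add: zigzag_Cons)
  qed (auto simp: zigzag_Cons)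
qed

text \<open>The step from \<open>(a, b)\<close> to \<open>(Suc a, b - 1)\<close> preserves
  \<open>a + b\<close>, so both formulas pass unchanged to the recursive call.\<close>

lemma chain_zigzag:
  assumes "\<forall>x\<in>{a..b}. x < (a + b + 1) div 2 \<longrightarrow> f x = a + b - x"
    and "\<forall>x\<in>{a..b}. (a + b + 1) div 2 < x \<longrightarrow> f x = a + b + 1 - x"
  shows "chain f (zigzag a b)"
  using assms
proof (induction a b rule: zigzag.induct)
  case (1 a b)
  consider "b < a" | "a = b" | "b = Suc a" | "Suc a < b" by linarith
  then show ?case
  proof cases
    case 4
    have e: "Suc a + (b - 1) = a + b" "Suc a + (b - 1) + 1 = a + b + 1" using 4 by auto
    have "chain f (zigzag (Suc a) (b - 1))"
    proof (rule "1.IH")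
      show "\<forall>x\<in>{Suc a..b - 1}. x < (Suc a + (b - 1) + 1) div 2 \<longrightarrow> f x = Suc a + (b - 1) - x"
        "\<forall>x\<in>{Suc a..b - 1}. (Suc a + (b - 1) + 1) div 2 < x \<longrightarrow> f x = Suc a + (b - 1) + 1 - x"
        unfolding e using "1.prems" by auto
    qed (use 4 in auto)
    moreover have "f a = b" "f b = Suc a" using 4 "1.prems" by auto
    ultimately show ?thesis using 4 by (simp add: zigzag_Cons successively_Cons)
  next
    case 3
    then have "f a = b" using "1.prems"(1) by auto
    then show ?thesis using 3 by (simp add: zigzag_Cons)
  qed auto
qed

text \<open>The threshold between the two formulas is \<open>last w\<close>, not the midpoint: where
  the chain ends is unknown in advance and only follows from the conclusion. Both
  \<open>a + b\<close> and the last entry stay the same when the first two entries are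
  removed.\<close>

lemma chain_eq_zigzag:
  assumes "distinct w" "set w = {a..b}" "w \<noteq> []" "hd w = a" "chain f w"
    and "\<forall>x\<in>{a..b}. x < last w \<longrightarrow> f x = a + b - x"
    and "\<forall>x\<in>{a..b}. last w < x \<longrightarrow> f x = a + b + 1 - x"
  shows "w = zigzag a b"
  using assms
proof (induction a b arbitrary: w rule: zigzag.induct)
  case (1 a b)
  obtain v where w: "w = a # v" using "1.prems"(3,4) by (cases w) auto
  have mem: "x = a \<or> x \<in> set v \<longleftrightarrow> a \<le> x \<and> x \<le> b" for x
    using "1.prems"(2) unfolding w set_eq_iff by simp
  have dist: "a \<notin> set v" "distinct v" using "1.prems"(1) unfolding w by simp_all
  have "a \<le> b" using mem[of a] by simp
  show ?case
  proof (cases "a = b")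
    case True
    then have "set v = {}" using mem dist(1) by (metis antisym equals0I)
    then show ?thesis using True w by simp
  next
    case False
    then have "a < b" using \<open>a \<le> b\<close> by simp
    have "b \<in> set v" using mem[of b] \<open>a < b\<close> by simp
    then have "v \<noteq> []" by auto
    then have "last w \<in> set v" unfolding w by simp
    then have "a < last w" using mem[of "last w"] dist(1) by (metis le_neq_implies_less)
    then have fa: "f a = b" using "1.prems"(6)[rule_format, of a] \<open>a \<le> b\<close> by simp
    then obtain u where v: "v = b # u" using "1.prems"(5) \<open>v \<noteq> []\<close> unfolding w by (cases v) simp_all
    have setu: "set u = {Suc a..b - 1}"
    proof -
      have "x \<in> set u \<longleftrightarrow> x \<in> {Suc a..b - 1}" for x
        using mem[of x] dist \<open>a < b\<close> unfolding v by (cases "x = a"; cases "x = b") auto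
      then show ?thesis by blast
    qed
    show ?thesis
    proof (cases "u = []")
      case True
      then have "b = Suc a" using setu \<open>a < b\<close> by auto
      then show ?thesis unfolding w v True by (simp add: zigzag_Cons)
    next
      case False
      have lu: "last w = last u" using False w v by simp
      have "last u \<in> set u" using False by simp
      then have "last u \<in> {Suc a..b - 1}" unfolding setu .
      then have "last w < b" "Suc a \<le> b - 1" using \<open>a < b\<close> unfolding lu by auto
      then have "f b = Suc a" using "1.prems"(7)[rule_format, of b] \<open>a < b\<close> by simp
      then have hu: "hd u = Suc a" using "1.prems"(5) w v False by (simp add: successively_Cons)
      have e: "Suc a + (b - 1) = a + b" using \<open>a < b\<close> by simp
      have u: "u = zigzag (Suc a) (b - 1)"
      proof (rule "1.IH")
        show "\<not> b < a" "a \<noteq> b" using \<open>a < b\<close> by auto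
        show "distinct u" using dist(2) unfolding v by simp
        show "chain f u" using "1.prems"(5) False unfolding w v successively_Cons by blast
        have sub: "{Suc a..b - 1} \<subseteq> {a..b}" by auto
        show "\<forall>x\<in>{Suc a..b - 1}. x < last u \<longrightarrow> f x = Suc a + (b - 1) - x"
          unfolding e using "1.prems"(6) sub unfolding lu by blast
        show "\<forall>x\<in>{Suc a..b - 1}. last u < x \<longrightarrow> f x = Suc a + (b - 1) + 1 - x"
          unfolding e using "1.prems"(7) sub unfolding lu by blast
        show "set u = {Suc a..b - 1}" "u \<noteq> []" "hd u = Suc a" by fact+
      qed
      show ?thesis unfolding w v zigzag_Cons[OF \<open>a < b\<close>] using u by blast
    qed
  qed
qed

section \<open>Decreasing maps onto an interval\<close>

text \<open>The values of the arguments above \<open>i\<close> are exactly the values in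
  \<open>{u..<f i}\<close>, so \<open>f i\<close> is known from the rank of
  \<open>i\<close>.\<close>

lemma strict_antimono_on_interval_image:
  fixes f :: "nat \<Rightarrow> nat"
  assumes "strict_antimono_on D f" "finite D" "f ` D = {u..v}" "i \<in> D"
  shows "f i = u + card {x \<in> D. i < x}"
proof -
  have anti: "f y < f x" if "x \<in> D" "y \<in> D" "x < y" for x y
    using monotone_onD[OF assms(1) that] .
  have mem: "y \<in> f ` D \<longleftrightarrow> u \<le> y \<and> y \<le> v" for y
    unfolding assms(3) by simp
  have fi: "u \<le> f i" "f i \<le> v" using mem[of "f i"] assms(4) by simp_all
  have "f ` {x \<in> D. i < x} = {u..<f i}"
  proof (intro equalityI subsetI)
    fix y assume "y \<in> f ` {x \<in> D. i < x}"
    then obtain x where x: "x \<in> D" "i < x" "y = f x" by blast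
    then have "u \<le> y" using mem[of y] by blast
    then show "y \<in> {u..<f i}" using anti[OF assms(4) x(1,2)] x(3) by simp
  next
    fix y assume y: "y \<in> {u..<f i}"
    then have "y \<in> f ` D" using mem[of y] fi by simp
    then obtain x where x: "x \<in> D" "y = f x" by blast
    have "f x < f i" using y x by simp
    then have "i < x" using anti[OF x(1) assms(4)] by (metis less_asym linorder_neqE_nat)
    then show "y \<in> f ` {x \<in> D. i < x}" using x by blast
  qed
  moreover have "inj_on f {x \<in> D. i < x}"
    by (rule inj_onI) (metis (no_types, lifting) anti less_irrefl linorder_neqE_nat mem_Collect_eq)
  ultimately have "card {x \<in> D. i < x} = f i - u"
    using card_image by (metis card_atLeastLessThan)
  then show ?thesis using fi by simp
qed

lemma chain_map_butlast: "chain f (x # w) \<Longrightarrow> map f (butlast (x # w)) = w"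
  by (induction w arbitrary: x) (auto simp: successively_Cons)

lemma chain_image:
  assumes "chain f (x # w)" "distinct (x # w)"
  shows "f ` (set (x # w) - {last (x # w)}) = set w"
proof -
  have "map f (butlast (x # w)) = w" by (rule chain_map_butlast[OF assms(1)])
  moreover have "set (butlast (x # w)) = set (x # w) - {last (x # w)}"
  proof -
    have eq: "butlast (x # w) @ [last (x # w)] = x # w" by (rule append_butlast_last_id) simp
    have "distinct (butlast (x # w) @ [last (x # w)])" unfolding eq by (rule assms(2))
    then have "last (x # w) \<notin> set (butlast (x # w))" by simp
    moreover have "set (x # w) = insert (last (x # w)) (set (butlast (x # w)))"
      by (metis Un_insert_right eq list.simps(15) set_append sup_bot_right empty_set)
    ultimately show ?thesis by blast
  qed
  ultimately show ?thesis by (metis list.set_map)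
qed

text \<open>The missing argument \<open>p\<close> lowers the rank only for arguments below it; this
  is the shift by one between the two formulas of \<open>chain_eq_zigzag\<close>.\<close>

lemma card_above_gap:
  fixes a b i p :: nat
  assumes "i \<in> {a..b}" "p \<in> {a..b}"
  shows "i < p \<Longrightarrow> card {x \<in> {a..b} - {p}. i < x} = b - i - 1"
    and "p < i \<Longrightarrow> card {x \<in> {a..b} - {p}. i < x} = b - i"
proof -
  have "{x \<in> {a..b} - {p}. i < x} = {Suc i..b} - {p}" using assms by auto
  then show "i < p \<Longrightarrow> card {x \<in> {a..b} - {p}. i < x} = b - i - 1"
    and "p < i \<Longrightarrow> card {x \<in> {a..b} - {p}. i < x} = b - i"
    using assms by (simp_all add: card_Diff_singleton_if)
qed

text \<open>The image of the block without its last entry is \<open>{Suc a..b}\<close>; ranks in it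
  give precisely the two formulas of a zigzag.\<close>

lemma decreasing_chain_from_min:
  assumes "distinct w" "set w = {a..b}" "w \<noteq> []" "hd w = a" "chain f w"
    and anti: "strict_antimono_on ({a..b} - {last w}) f"
  shows "w = zigzag a b"
proof -
  obtain v where w: "w = a # v" using assms(3,4) by (cases w) auto
  have "set v = set w - {a}" using w assms(1) by simp
  moreover have "{a..b} - {a} = {Suc a..b}" by auto
  ultimately have v: "set v = {Suc a..b}" unfolding assms(2) by simp
  have im: "f ` ({a..b} - {last w}) = {Suc a..b}"
    using chain_image[of f a v] assms(1,5) w v unfolding assms(2)[symmetric] by simp
  have p: "last w \<in> {a..b}" using last_in_set[OF assms(3)] unfolding assms(2) .
  have val: "f x = Suc a + card {y \<in> {a..b} - {last w}. x < y}" if "x \<in> {a..b}" "x \<noteq> last w" for x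
    by (rule strict_antimono_on_interval_image[OF anti _ im]) (use that in auto)
  have "f x = a + b - x" if "x \<in> {a..b}" "x < last w" for x
    using val[of x] that card_above_gap(1)[OF that(1) p that(2)] p by auto
  moreover have "f x = a + b + 1 - x" if "x \<in> {a..b}" "last w < x" for x
    using val[of x] that card_above_gap(2)[OF that(1) p that(2)] p by auto
  ultimately show ?thesis by (intro chain_eq_zigzag[OF assms(1-5)] ballI impI)
qed

text \<open>Now the image is \<open>{a..b - 1}\<close>. The largest argument \<open>b\<close> takes
  the least value \<open>a\<close>, and the rest is a chain on \<open>{a..b - 1}\<close> starting at
  its minimum. With \<open>1 \<le> b\<close> the difference \<open>b - 1\<close> is a true one, so
  the zigzag is empty for \<open>a = b\<close>.\<close>

lemma decreasing_chain_from_max: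
  assumes "distinct (b # w)" "set (b # w) = {a..b}" "1 \<le> b" "chain f (b # w)"
    and anti: "strict_antimono_on ({a..b} - {last (b # w)}) f"
  shows "w = zigzag a (b - 1)"
proof (cases "w = []")
  case True
  then have "x = b \<longleftrightarrow> a \<le> x \<and> x \<le> b" for x
    using assms(2) unfolding set_eq_iff by simp
  from this[of a] this[of b] have "a = b" by simp
  then show ?thesis using True assms(3) by simp
next
  case False
  have "set w = set (b # w) - {b}" using assms(1) by simp
  moreover have "{a..b} - {b} = {a..b - 1}" using assms(3) by auto
  ultimately have w: "set w = {a..b - 1}" unfolding assms(2) by simp
  have im: "f ` ({a..b} - {last (b # w)}) = {a..b - 1}"
    using chain_image[OF assms(4,1)] w unfolding assms(2) by simp
  have lw: "last (b # w) = last w" using False by simp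
  have p': "last w \<in> {a..b - 1}" using last_in_set[OF False] unfolding w .
  then have p: "last w \<in> {a..b}" by auto
  have val: "f x = a + card {y \<in> {a..b} - {last w}. x < y}" if "x \<in> {a..b}" "x \<noteq> last w" for x
    unfolding lw[symmetric]
    by (rule strict_antimono_on_interval_image[OF anti _ im]) (use that lw in auto)
  have "f b = a" using val[of b] card_above_gap(2)[of b a b "last w"] p p' assms(3) by auto
  then have hd: "hd w = a" using assms(4) False by (simp add: successively_Cons)
  have "f x = a + (b - 1) - x" if "x \<in> {a..b - 1}" "x < last w" for x
    using val[of x] that card_above_gap(1)[of x a b "last w"] p p' by auto
  moreover have "f x = a + (b - 1) + 1 - x" if "x \<in> {a..b - 1}" "last w < x" for x
    using val[of x] that card_above_gap(2)[of x a b "last w"] p p' by auto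
  moreover have "distinct w" "chain f w" using assms(1,4) False by (auto simp: successively_Cons)
  ultimately show ?thesis by (intro chain_eq_zigzag[OF _ w False hd] ballI impI)
qed

text \<open>Applying \<open>f\<close> along the word rotates it, and a rotation has no repetition
  either.\<close>

lemma cycle_word_inj:
  assumes "cycle_word n f w" "w \<noteq> []"
  shows "inj_on f {1..n}"
proof -
  obtain x v where w: "w = x # v" using assms(2) by (cases w) auto
  have "map f (butlast w) = v" unfolding w
    by (rule chain_map_butlast) (use assms(1) in \<open>simp only: w cycle_word_def\<close>)
  then have "map f w = v @ [1]"
    using assms append_butlast_last_id[of w]
    by (metis cycle_word_def list.simps(8,9) map_append)
  moreover have "distinct (v @ [1])" using assms(1) w by (auto simp: cycle_word_def)
  ultimately have "inj_on f (set w)" by (metis distinct_map)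
  then show ?thesis using assms(1) by (simp add: cycle_word_def)
qed

lemma distinct_hd_eq_last:
  assumes "distinct w" "w \<noteq> []" "hd w = last w"
  shows "w = [hd w]"
  using assms by (cases w) (auto split: if_splits dest: last_in_set)

section \<open>Classification of the words\<close>

locale good_cycle =
  fixes n :: nat and f :: "nat \<Rightarrow> nat" and w :: "nat list"
  assumes large: "8 \<le> n"
    and cycle: "cycle_word n f w"
    and avoids_w: "avoids_231 w"
    and avoids_f: "avoids_123 n f"
begin

lemma distinct_w: "distinct w" and set_w: "set w = {1..n}" and chain_w: "chain f w"
  and f_last: "f (last w) = 1"
  using cycle by (auto simp: cycle_word_def)

lemma no_123: "1 \<le> i \<Longrightarrow> i < j \<Longrightarrow> j < k \<Longrightarrow> k \<le> n \<Longrightarrow> f i < f j \<Longrightarrow> f j < f k \<Longrightarrow> False"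
  using avoids_f unfolding avoids_123_def by blast

lemma f_inj: "inj_on f {1..n}"
  using cycle large by (intro cycle_word_inj) (auto simp: cycle_word_def)

lemma decreasingI:
  assumes "D \<subseteq> {1..n}"
    and "\<And>i j. i \<in> D \<Longrightarrow> j \<in> D \<Longrightarrow> i < j \<Longrightarrow> f i < f j \<Longrightarrow> False"
  shows "strict_antimono_on D f"
proof (rule monotone_onI)
  fix i j assume ij: "i \<in> D" "j \<in> D" "i < j"
  then have "f i \<noteq> f j" using f_inj assms(1) by (metis inj_onD less_irrefl subsetD)
  then show "f j < f i" using assms(2)[OF ij] by (metis linorder_neqE_nat)
qed

text \<open>The entries before \<open>n\<close> form an initial interval. The arrow from
  \<open>n\<close> lands above that interval and completes every ascent in it; the arrow from 1
  lands inside it and completes every ascent of the upper block.\<close>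

lemma max_inside:
  assumes w: "w = 1 # u @ n # v" and "u \<noteq> []" "v \<noteq> []"
  shows "\<exists>j. 2 \<le> j \<and> j \<le> n - 2 \<and> w = zigzag 1 j @ n # zigzag (Suc j) (n - 1)"
proof -
  have dist: "distinct (1 # u)" "distinct (n # v)" "set (1 # u) \<inter> set (n # v) = {}"
    using distinct_w w by auto
  have un: "set (1 # u) \<union> set v = {1..n - 1}"
  proof -
    have "set (1 # u) \<union> set v = set w - {n}" using distinct_w unfolding w by auto
    moreover have "{1..n} - {n} = {1..n - 1}" using large by auto
    ultimately show ?thesis unfolding set_w by simp
  qed
  have "x < n" if "x \<in> set (1 # u)" for x
  proof -
    have "x \<in> {1..n - 1}" using that unfolding un[symmetric] by blast
    then show ?thesis using large by auto
  qed
  then have "x \<le> y" if "x \<in> set (1 # u)" "y \<in> set v" for x y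
    using avoids_231_max_split[of "1 # u" n v x y] avoids_w that unfolding w by simp
  then have "\<forall>x\<in>set (1 # u). \<forall>y\<in>set v. x < y"
    using dist(3) by (metis disjoint_iff le_neq_implies_less list.set_intros(2))
  then obtain j where j: "set (1 # u) = {1..j}" "set v = {Suc j..n - 1}"
    using interval_split[OF un] by (metis empty_set list.distinct(1) set_empty)
  have hdu: "hd u \<in> {1..j}" "hd u \<noteq> 1" and hdv: "hd v \<in> {Suc j..n - 1}"
    using assms(2,3) j dist(1) hd_in_set by (metis distinct.simps(2) list.set_intros(2))+
  then have j_bounds: "2 \<le> j" "j \<le> n - 2" by auto
  have ch: "chain f (1 # u)" "chain f (n # v)" "f (last (1 # u)) = n"
    using chain_w assms(2,3) unfolding w by (simp_all add: successively_append_iff successively_Cons)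
  have f1: "f 1 = hd u" and fn: "f n = hd v"
    using ch(1,2) assms(2,3) by (simp_all add: successively_Cons)
  have "insert n {Suc j..n - 1} = {Suc j..n}" using j_bounds large by auto
  then have setn: "set (n # v) = {Suc j..n}" using j(2) by simp
  have "1 # u = zigzag 1 j"
  proof (rule decreasing_chain_from_min)
    show "strict_antimono_on ({1..j} - {last (1 # u)}) f"
    proof (rule decreasingI)
      show "{1..j} - {last (1 # u)} \<subseteq> {1..n}" using j_bounds by auto
      fix i i' assume *: "i \<in> {1..j} - {last (1 # u)}" "i' \<in> {1..j} - {last (1 # u)}" "i < i'" "f i < f i'"
      have "f i' \<in> set u" using chain_image[OF ch(1) dist(1)] * j(1) by blast
      then have "f i' \<in> {1..j}" unfolding j(1)[symmetric] by simp
      then have "f i' < f n" using hdv fn by simp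
      moreover have "i' < n" using * j_bounds large by auto
      ultimately show False using no_123[of i i' n] *(1,3,4) by simp
    qed
    show "distinct (1 # u)" "set (1 # u) = {1..j}" "chain f (1 # u)" by fact+
  qed simp_all
  moreover have "v = zigzag (Suc j) (n - 1)"
  proof (rule decreasing_chain_from_max)
    show "strict_antimono_on ({Suc j..n} - {last (n # v)}) f"
    proof (rule decreasingI)
      show "{Suc j..n} - {last (n # v)} \<subseteq> {1..n}" by auto
      fix i i' assume *: "i \<in> {Suc j..n} - {last (n # v)}" "i' \<in> {Suc j..n} - {last (n # v)}" "i < i'" "f i < f i'"
      have "f i \<in> set v" using chain_image[OF ch(2) dist(2)] * setn by blast
      then have "f 1 < f i" using hdu unfolding j(2) f1 by simp
      then show False using no_123[of 1 i i'] * j_bounds large by auto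
    qed
    show "distinct (n # v)" "set (n # v) = {Suc j..n}" "1 \<le> n" "chain f (n # v)"
      using dist ch setn large by simp_all
  qed
  ultimately show ?thesis using w j_bounds by (intro exI[of _ j]) simp
qed

text \<open>
  A block that starts with its maximum is a zigzag by \<open>decreasing_chain_from_max\<close>. The next lemma
  leaves hardly any other first entry \<open>k \<ge> 3\<close>: the entries below \<open>k\<close> precede those above \<open>k\<close>,
  and the arrows leaving the two parts then force an increasing triple unless the parts are tiny.
\<close>

lemma inner_block:
  assumes dist: "distinct (k # u)" and st: "set (k # u) = {2..j}"
    and ch: "chain f (k # u)" and av: "avoids_231 (k # u)"
    and k: "3 \<le> k" "k < j" and M: "j < f (last (k # u))" and t: "j < t" "t \<le> n" "f t = k"
  shows "k = 3 \<and> (j = 4 \<and> u = [2, 4] \<or> j = 5 \<and> u = [2, 5, 4])"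
proof -
  obtain u1 u2 where u: "u = u1 @ u2" "\<forall>y\<in>set u1. y < k" "\<forall>y\<in>set u2. k < y"
    using avoids_231_hd_split[OF av] dist by auto
  have mem: "y \<in> set (k # u) \<longleftrightarrow> 2 \<le> y \<and> y \<le> j" for y unfolding st by simp
  have mem12: "y = k \<or> y \<in> set u1 \<or> y \<in> set u2 \<longleftrightarrow> 2 \<le> y \<and> y \<le> j" for y
    using mem[of y] u(1) by simp
  have set1: "set u1 = {2..k - 1}"
  proof (rule set_eqI)
    fix y show "y \<in> set u1 \<longleftrightarrow> y \<in> {2..k - 1}" using mem12[of y] u(2,3) k by auto
  qed
  have set2: "set u2 = {Suc k..j}"
  proof (rule set_eqI)
    fix y show "y \<in> set u2 \<longleftrightarrow> y \<in> {Suc k..j}" using mem12[of y] u(2,3) k by auto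
  qed
  have ne: "u1 \<noteq> []" "u2 \<noteq> []" using set1 set2 k by auto
  obtain x u3 where x: "u2 = x # u3" using ne by (cases u2) auto
  define y where "y = last u1"
  define p where "p = last u2"
  have ch': "chain f (k # u1)" "chain f u2" "f y = x" "f k = hd u1" "chain f u1"
    using ch ne unfolding u(1) x y_def
    by (simp_all add: successively_append_iff successively_Cons)
  have dist': "distinct (k # u1)" "distinct u2" "distinct u1" using dist u(1) by auto
  have fp: "j < f p" using M ne u(1) unfolding p_def by simp
  have p: "p \<in> {Suc k..j}" using ne set2 unfolding p_def by (metis last_in_set)
  have x_mem: "x \<in> {Suc k..j}" using set2 x by (metis list.set_intros(1))
  have y_mem: "y \<in> {2..k - 1}" using ne set1 unfolding y_def by (metis last_in_set)
  have f_u2: "f i \<in> set u3" if "i \<in> {Suc k..j}" "i \<noteq> p" for i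
    using chain_image[of f x u3] ch'(2) dist'(2) that set2 unfolding x p_def by blast
  have u3_le: "z \<in> {Suc k..j}" if "z \<in> set u3" for z using set2 x that by (metis list.set_intros(2))
  have f_u2_gt: "k < f i" if "i \<in> {Suc k..j}" for i
    using f_u2[of i] u3_le[of "f i"] that fp k by (cases "i = p") auto
  have "hd u1 \<in> {2..k - 1}" using ne set1 by (metis hd_in_set)
  then have fk: "f k < k" using ch'(4) by auto
  \<comment> \<open>An ascent here would be preceded by \<open>k\<close>, whose value is below
    \<open>k\<close> while all values on this part exceed \<open>k\<close>. The exit
    \<open>p\<close> is included.\<close>
  have anti2: "f i' < f i" if "i \<in> {Suc k..j}" "i' \<in> {Suc k..j}" "i < i'" for i i'
  proof -
    have "strict_antimono_on {Suc k..j} f"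
    proof (rule decreasingI)
      show "{Suc k..j} \<subseteq> {1..n}" using t by auto
      fix i i' assume *: "i \<in> {Suc k..j}" "i' \<in> {Suc k..j}" "i < i'" "f i < f i'"
      then show False using no_123[of k i i'] f_u2_gt[of i] fk k t by auto
    qed
    then show ?thesis using that by (rule monotone_onD)
  qed
  \<comment> \<open>Only \<open>p\<close> takes a value above \<open>j\<close>, and the largest
    value of a decreasing map belongs to the least argument.\<close>
  have p_eq: "p = Suc k"
  proof (rule ccontr)
    assume "p \<noteq> Suc k"
    then have "f p < f (Suc k)" "f (Suc k) \<in> set u3"
      using anti2[of "Suc k" p] f_u2[of "Suc k"] p k by auto
    then show False using u3_le[of "f (Suc k)"] fp by simp
  qed
  have "f ` (set u1 - {y}) = set (tl u1)"
    using chain_image[of f "hd u1" "tl u1"] ch'(5) dist'(3) ne(1) unfolding y_def by simp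
  then have f_u1: "f i \<in> set (tl u1)" if "i \<in> {2..k - 1}" "i \<noteq> y" for i
    using that unfolding set1 by blast
  \<comment> \<open>Otherwise 2 < y < p is an increasing triple: 2 stays in the lower part,
    \<open>y\<close> leads to the upper part and \<open>p\<close> leads out of the block.\<close>
  have y_eq: "y = 2"
  proof (rule ccontr)
    assume "y \<noteq> 2"
    then have "f 2 \<in> set (tl u1)" using f_u1[of 2] y_mem by simp
    then have "f 2 \<in> {2..k - 1}" using list.set_sel(2)[OF ne(1)] unfolding set1 by simp
    then have "f 2 < f y" "f y < f p" using x_mem fp k unfolding ch'(3) by auto
    moreover have "2 < y" "y < p" "p \<le> n" using y_mem p t \<open>y \<noteq> 2\<close> by auto
    ultimately show False using no_123[of 2 y p] by simp
  qed
  \<comment> \<open>Ascents in the lower part are completed on the right by \<open>t\<close>, whose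
    value \<open>k\<close> is above that part.\<close>
  have "u1 = zigzag 2 (k - 1)"
  proof (rule decreasing_chain_from_max)
    have "insert k {2..k - 1} = {2..k}" using k by auto
    then show st1: "set (k # u1) = {2..k}" using set1 by simp
    show "strict_antimono_on ({2..k} - {last (k # u1)}) f"
    proof (rule decreasingI)
      show "{2..k} - {last (k # u1)} \<subseteq> {1..n}" using k t by auto
      fix i i' assume *: "i \<in> {2..k} - {last (k # u1)}" "i' \<in> {2..k} - {last (k # u1)}" "i < i'" "f i < f i'"
      have "f i' \<in> set u1" using chain_image[OF ch'(1) dist'(1)] * st1 by blast
      then have "f i' < f t" unfolding set1 t(3) using k by auto
      then show False using no_123[of i i' t] *(1-4) t(1,2) k by simp
    qed
    show "distinct (k # u1)" "1 \<le> k" "chain f (k # u1)" using dist' ch' k by simp_all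
  qed
  then have "hd u1 = 2" using k by simp
  \<comment> \<open>The zigzag starts with 2 and also ends with \<open>y = 2\<close>, so the lower
    part has one element.\<close>
  then have u1: "u1 = [2]" using distinct_hd_eq_last[OF dist'(3) ne(1)] y_eq unfolding y_def by simp
  then have "2 \<in> {2..k - 1}" "k - 1 \<in> set u1" using set1 k by auto
  then have k3: "k = 3" using u1 by auto
  have p4: "p = 4" using p_eq k3 by simp
  show ?thesis
  proof (cases "u3 = []")
    case True
    then have "u2 = [4]" using x p4 unfolding p_def by simp
    moreover have "j \<in> set u2" using set2 k by simp
    ultimately show ?thesis using u u1 k3 by simp
  next
    case False
    then have last3: "last u3 = 4" using p4 x unfolding p_def by simp
    then have "4 \<in> set u3" using last_in_set[OF False] by simp
    then have "x \<noteq> 4" using dist'(2) x by auto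
    \<comment> \<open>The upper part ends in its minimum 4, so anything larger than \<open>x\<close>
      between them would create \<open>x j 4\<close>, a pattern 231.\<close>
    have xj: "x = j"
    proof (rule ccontr)
      assume "x \<noteq> j"
      have "j \<in> set u2" using set2 k by simp
      then have "j \<in> set u3" using x \<open>x \<noteq> j\<close> by simp
      moreover have "j \<noteq> 4" "4 < x" "x < j" using x_mem \<open>x \<noteq> j\<close> \<open>x \<noteq> 4\<close> k3 by auto
      moreover have u3: "u3 = butlast u3 @ [4]" using last3 False by (metis append_butlast_last_id)
      ultimately have "j \<in> set (butlast u3)" by (metis Un_iff empty_set list.simps(15) set_append singletonD)
      then have "subseq ([x] @ [j] @ [4]) ([x] @ butlast u3 @ [4])"
        by (intro list_emb_append_mono) (auto simp: subseq_singleton_left)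
      then have "subseq [x, j, 4] u2" unfolding x using u3 by simp
      then have "subseq [x, j, 4] (k # u)" unfolding u(1) by (metis append_Cons subseq_drop_many)
      then show False using av \<open>4 < x\<close> \<open>x < j\<close> unfolding avoids_231_def by blast
    qed
    have "j \<noteq> 4" using xj \<open>x \<noteq> 4\<close> by simp
    have "4 \<in> f ` (set u2 - {p})"
      using chain_image[of f x u3] ch'(2) dist'(2) \<open>4 \<in> set u3\<close> unfolding x p_def by simp
    then obtain i where "i \<in> set u2 - {p}" "4 = f i" by (rule imageE)
    then have i: "i \<in> {Suc k..j}" "f i = 4" unfolding set2 by simp_all
    \<comment> \<open>Inside the block 4 is the least possible value, so it belongs to the largest
      argument \<open>j\<close>. As \<open>j\<close> comes first in the upper part, 4 comes second
      and also last.\<close>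
    have "i = j"
    proof (rule ccontr)
      assume "i \<noteq> j"
      then have "f j < 4" using anti2[of i j] i by auto
      moreover have "f j \<in> set u3" using f_u2[of j] p4 \<open>j \<noteq> 4\<close> k by auto
      ultimately show False using u3_le[of "f j"] k3 by auto
    qed
    then have "hd u3 = 4" using i ch'(2) False xj unfolding x by (simp add: successively_Cons)
    then have u3: "u3 = [4]" using distinct_hd_eq_last[of u3] last3 dist'(2) False unfolding x by simp
    have "5 \<in> set u2" using set2 k3 k \<open>j \<noteq> 4\<close> by auto
    then have "j = 5" using x u3 xj by auto
    then show ?thesis using u(1) u1 x u3 xj k3 by simp
  qed
qed

text \<open>The first alternative is a block starting with its maximum \<open>j\<close>; the second
  is the exceptional block 3 2 4 of \<open>inner_block\<close>.\<close>

lemma max_second: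
  assumes w: "w = 1 # n # k # T" and k2: "k \<noteq> 2"
  shows "(\<exists>j. 3 \<le> j \<and> j \<le> n - 2 \<and> w = 1 # n # j # zigzag 2 (j - 1) @ (n - 1) # zigzag (Suc j) (n - 2))
       \<or> w = 1 # n # 3 # 2 # 4 # (n - 1) # zigzag 5 (n - 2)"
proof -
  have kT: "set (k # T) = {2..n - 1}"
  proof -
    have "set (k # T) = set w - {1, n}" using distinct_w unfolding w by auto
    moreover have "{1..n} - {1, n} = {2..n - 1}" by auto
    ultimately show ?thesis unfolding set_w by simp
  qed
  have "k \<in> {2..n - 1}" using kT by (metis list.set_intros(1))
  then have k: "3 \<le> k" "k \<le> n - 1" using k2 by auto
  have fn: "f n = k" using chain_w unfolding w by simp
  \<comment> \<open>If \<open>k = n - 1\<close>, the arguments \<open>last w < k < n\<close> take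
    the increasing values 1, \<open>f k\<close> and \<open>n - 1\<close>.\<close>
  have "k \<noteq> n - 1"
  proof
    assume "k = n - 1"
    have "n - 2 \<in> set (k # T)" unfolding kT using large by auto
    then have T: "T \<noteq> []" using \<open>k = n - 1\<close> large by auto
    have "hd T \<in> set T" using T by simp
    then have "hd T \<in> {2..n - 1}" "hd T \<noteq> k" using distinct_w unfolding w kT[symmetric] by auto
    moreover have "f k = hd T" using chain_w T unfolding w by (simp add: successively_Cons)
    ultimately have fk: "2 \<le> f k" "f k < n - 1" using \<open>k = n - 1\<close> by auto
    have "last w \<in> set T" unfolding w using T by simp
    then have "last w \<in> {2..n - 1}" "last w \<noteq> k" using distinct_w unfolding kT[symmetric] by (auto simp: w)
    then have "2 \<le> last w" "last w < k" "k < n" using \<open>k = n - 1\<close> by auto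
    then show False using no_123[of "last w" k n] f_last fk fn \<open>k = n - 1\<close> by simp
  qed
  moreover have "n - 1 \<in> set (k # T)" unfolding kT using large by auto
  ultimately have "n - 1 \<in> set T" by auto
  then obtain L R where T: "T = L @ (n - 1) # R" by (metis split_list)
  define p where "p = last (k # L)"
  have dist: "distinct (k # L)" "distinct ((n - 1) # R)" "set (k # L) \<inter> set ((n - 1) # R) = {}"
    using distinct_w unfolding w T by auto
  have un: "set (k # L) \<union> set R = {2..n - 2}"
  proof -
    have "set (k # L) \<union> set R = set (k # T) - {n - 1}" using distinct_w unfolding w T by auto
    moreover have "{2..n - 1} - {n - 1} = {2..n - 2}" by auto
    ultimately show ?thesis unfolding kT by simp
  qed
  have lt: "x < n - 1" if "x \<in> set (k # L)" for x
  proof -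
    have "x \<in> {2..n - 2}" using that unfolding un[symmetric] by blast
    then show ?thesis by auto
  qed
  have av: "avoids_231 ((k # L) @ (n - 1) # R)"
    using avoids_w[unfolded w T, THEN avoids_231_ConsD, THEN avoids_231_ConsD] by simp
  have "x \<le> y" if "x \<in> set (k # L)" "y \<in> set R" for x y
    using avoids_231_max_split[OF av _ that] lt by blast
  then have "\<forall>x\<in>set (k # L). \<forall>y\<in>set R. x < y"
    using dist(3) by (metis disjoint_iff le_neq_implies_less list.set_intros(2))
  then obtain j where j: "set (k # L) = {2..j}" "set R = {Suc j..n - 2}" "j \<in> set (k # L)"
    using interval_split[OF un] by (metis empty_set list.distinct(1) set_empty)
  have "k \<in> {2..j}" using j(1) by (metis list.set_intros(1))
  then have kj: "k \<le> j" by simp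
  have jn: "j \<le> n - 2" using lt[OF j(3)] by simp
  have "2 \<in> set (k # L)" unfolding j(1) using k kj by simp
  then have L: "L \<noteq> []" using k2 by auto
  have ch: "chain f (k # L)" "chain f ((n - 1) # R)" "f p = n - 1" "f k = hd L"
    using chain_w L unfolding w T p_def by (simp_all add: successively_append_iff successively_Cons)
  have fk: "f k \<in> {2..j}" using L unfolding ch(4) j(1)[symmetric] by simp
  have setR: "set ((n - 1) # R) = {Suc j..n - 1}"
  proof -
    have "insert (n - 1) {Suc j..n - 2} = {Suc j..n - 1}" using jn large by auto
    then show ?thesis using j(2) by simp
  qed
  \<comment> \<open>The arrow from \<open>k\<close> stays in \<open>{2..j}\<close> and precedes
    every ascent of the block headed by \<open>n - 1\<close>.\<close>
  have R: "R = zigzag (Suc j) (n - 2)"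
  proof -
    have "R = zigzag (Suc j) (n - 1 - 1)"
    proof (rule decreasing_chain_from_max)
      show "strict_antimono_on ({Suc j..n - 1} - {last ((n - 1) # R)}) f"
      proof (rule decreasingI)
        show "{Suc j..n - 1} - {last ((n - 1) # R)} \<subseteq> {1..n}" by auto
        fix i i' assume *: "i \<in> {Suc j..n - 1} - {last ((n - 1) # R)}"
          "i' \<in> {Suc j..n - 1} - {last ((n - 1) # R)}" "i < i'" "f i < f i'"
        have "f i \<in> set R" using chain_image[OF ch(2) dist(2)] *(1) setR by blast
        then have "f k < f i" using fk unfolding j(2) by simp
        moreover have "k < i" "i' \<le> n" using *(1,2) kj by auto
        ultimately show False using no_123[of k i i'] *(3,4) k by simp
      qed
      show "distinct ((n - 1) # R)" "set ((n - 1) # R) = {Suc j..n - 1}" "1 \<le> n - 1" "chain f ((n - 1) # R)"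
        using dist ch setR large by simp_all
    qed
    then show ?thesis by (simp add: numeral_2_eq_2)
  qed
  show ?thesis
  proof (cases "k = j")
    case True
    \<comment> \<open>Here \<open>f n = k\<close> is above all values inside the block, so
      \<open>n\<close> completes any ascent.\<close>
    have "L = zigzag 2 (k - 1)"
    proof (rule decreasing_chain_from_max)
      show "strict_antimono_on ({2..k} - {last (k # L)}) f"
      proof (rule decreasingI)
        show "{2..k} - {last (k # L)} \<subseteq> {1..n}" using k by auto
        fix i i' assume *: "i \<in> {2..k} - {last (k # L)}" "i' \<in> {2..k} - {last (k # L)}" "i < i'" "f i < f i'"
        have "f i' \<in> set L" using chain_image[OF ch(1) dist(1)] *(2) j(1) True by blast
        then have "f i' \<in> {2..j}" "f i' \<noteq> k" using dist(1) unfolding j(1)[symmetric] by auto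
        then have "f i' < f n" unfolding fn using True by simp
        moreover have "i' < n" "1 \<le> i" using *(1,2) k by auto
        ultimately show False using no_123[of i i' n] *(3,4) by simp
      qed
      show "distinct (k # L)" "set (k # L) = {2..k}" "1 \<le> k" "chain f (k # L)"
        using dist ch j True k by simp_all
    qed
    then have "w = 1 # n # j # zigzag 2 (j - 1) @ (n - 1) # zigzag (Suc j) (n - 2)"
      unfolding w T R using True by simp
    then show ?thesis using k jn True by blast
  next
    case False
    have "avoids_231 (k # L)" using av by (rule avoids_231_appendD)
    then have "k = 3 \<and> (j = 4 \<and> L = [2, 4] \<or> j = 5 \<and> L = [2, 5, 4])"
      using dist(1) j(1) ch(1) k kj False jn ch(3) large fn unfolding p_def
      by (intro inner_block[where t = n]) auto
    then consider "k = 3" "j = 4" "L = [2, 4]" | "k = 3" "j = 5" "L = [2, 5, 4]" by blast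
    then show ?thesis
    proof cases
      case 1
      then show ?thesis unfolding w T R by simp
    next
      case 2
      \<comment> \<open>The block 3 2 5 4 contains the ascent 3 < 5, which \<open>n - 1\<close>
        completes because a nonempty block follows when n >= 8.\<close>
      have f35: "f 3 = 2" "f 5 = 4" using ch(1) 2 by simp_all
      have "R \<noteq> []" unfolding R 2(2) using large by simp
      then have "f (n - 1) \<in> set R" using ch(2) by (simp add: successively_Cons)
      then have "4 < f (n - 1)" unfolding j(2) 2(2) by simp
      moreover have "5 < n - 1" "n - 1 \<le> n" using large by auto
      ultimately have False using no_123[of 3 5 "n - 1"] f35 by simp
      then show ?thesis ..
    qed
  qed
qed

text \<open>The first alternative keeps its tail open: such words are shortened by two, not listed.
  Only a third entry \<open>n - 2\<close> gives a new word.\<close>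

lemma max_last:
  assumes w: "w = 1 # u @ [n]"
  shows "(\<exists>v. w = 1 # (n - 1) # 2 # v) \<or> w = 1 # (n - 1) # (n - 2) # zigzag 2 (n - 3) @ [n]"
proof -
  have su: "set u = {2..n - 1}"
  proof -
    have "set u = set w - {1, n}" using distinct_w unfolding w by auto
    moreover have "{1..n} - {1, n} = {2..n - 1}" by auto
    ultimately show ?thesis unfolding set_w by simp
  qed
  have "2 \<in> set u" unfolding su using large by simp
  then obtain k u' where u: "u = k # u'" by (cases u) auto
  have "k \<in> set u" using u by simp
  then have k: "2 \<le> k" "k \<le> n - 1" unfolding su by simp_all
  have "avoids_231 (k # u')"
    using avoids_w[unfolded w u, THEN avoids_231_ConsD] by (rule avoids_231_appendD)
  then obtain u1 u2 where u': "u' = u1 @ u2" "\<forall>y\<in>set u1. y < k" "\<forall>y\<in>set u2. k < y"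
    using avoids_231_hd_split[of k u'] distinct_w unfolding w u by auto
  have f1: "f 1 = k" using chain_w unfolding w u by simp
  \<comment> \<open>Otherwise larger entries follow \<open>k\<close>. The entry \<open>y\<close>
    leading up to them and the entry \<open>p\<close> leading to \<open>n\<close> form, together
    with 1, a triple with values \<open>k < x < n\<close>.\<close>
  have k_eq: "k = n - 1"
  proof (rule ccontr)
    assume "k \<noteq> n - 1"
    then have "n - 1 \<in> set u" "n - 1 \<noteq> k" "\<not> n - 1 < k" unfolding su using k by auto
    then have "n - 1 \<in> set u2" using u' unfolding u by auto
    then obtain x u3 where u2: "u2 = x # u3" by (cases u2) auto
    define y where "y = last (k # u1)"
    define p where "p = last u2"
    have fy: "f y = x" "f p = n" using chain_w unfolding w u u' u2 y_def p_def
      by (auto simp: successively_append_iff successively_Cons split: if_splits)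
    have "p \<in> set u2" "x \<in> set u2" unfolding p_def u2 by simp_all
    then have "p \<in> set u" "k < p" "x \<in> set u" "k < x" using u' unfolding u by auto
    then have px: "p \<le> n" "k < p" "k < x" "x < n" unfolding su using k by auto
    have "y \<in> set (k # u1)" unfolding y_def by simp
    then have "y \<in> set u" "y \<le> k" using u' unfolding u by auto
    then have "2 \<le> y" "y \<le> k" unfolding su by simp_all
    then show False using no_123[of 1 y p] f1 fy px by simp
  qed
  have sv: "set u' = {2..n - 2}"
  proof -
    have "set u' = set u - {n - 1}" using distinct_w k_eq unfolding w u by auto
    moreover have "{2..n - 1} - {n - 1} = {2..n - 2}" by auto
    ultimately show ?thesis unfolding su by simp
  qed
  have "2 \<in> set u'" unfolding sv using large by simp
  then obtain m v where v: "u' = m # v" by (cases u') auto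
  have "m \<in> set u'" using v by simp
  then have m: "2 \<le> m" "m \<le> n - 2" unfolding sv by simp_all
  have w': "w = 1 # (n - 1) # m # v @ [n]" unfolding w u v k_eq by simp
  have fm: "f (n - 1) = m" "chain f (m # v)" "f (last (m # v)) = n"
    using chain_w unfolding w' by (cases "v = []"; simp add: successively_append_iff successively_Cons)+
  have dist: "distinct (m # v)" using distinct_w unfolding w' by simp
  consider "m = 2" | "m = n - 2" | "3 \<le> m" "m < n - 2" using m by linarith
  then show ?thesis
  proof cases
    case 1
    then show ?thesis using w' by blast
  next
    case 2
    \<comment> \<open>The completing arrow is the one from \<open>n - 1\<close>, with value
      \<open>m\<close>, the maximum of the block.\<close>
    have "v = zigzag 2 (m - 1)"
    proof (rule decreasing_chain_from_max)
      show st: "set (m # v) = {2..m}" using sv unfolding v 2 .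
      show "strict_antimono_on ({2..m} - {last (m # v)}) f"
      proof (rule decreasingI)
        show "{2..m} - {last (m # v)} \<subseteq> {1..n}" using 2 by auto
        fix i i' assume *: "i \<in> {2..m} - {last (m # v)}" "i' \<in> {2..m} - {last (m # v)}" "i < i'" "f i < f i'"
        have "f i' \<in> set v" using chain_image[OF fm(2) dist] *(2) st by blast
        then have "f i' \<in> {2..m}" "f i' \<noteq> m" using dist unfolding st[symmetric] by auto
        then have "f i' < f (n - 1)" unfolding fm(1) by simp
        moreover have "i' < n - 1" "1 \<le> i" using *(1,2) 2 large by auto
        ultimately show False using no_123[of i i' "n - 1"] *(3,4) by simp
      qed
      show "distinct (m # v)" "1 \<le> m" "chain f (m # v)" using dist m fm by simp_all
    qed
    then have "w = 1 # (n - 1) # (n - 2) # zigzag 2 (n - 3) @ [n]" unfolding w' 2 by (simp add: numeral_eq_Suc)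
    then show ?thesis ..
  next
    case 3
    have "avoids_231 (m # v)"
      using avoids_231_appendD(1)[of "m # v" "[n]"]
        avoids_w[unfolded w', THEN avoids_231_ConsD, THEN avoids_231_ConsD] by simp
    \<comment> \<open>The exceptional blocks would have maximum \<open>n - 2\<close>, that is 4 or
      5; this is excluded by n >= 8.\<close>
    then have "m = 3 \<and> (n - 2 = 4 \<and> v = [2, 4] \<or> n - 2 = 5 \<and> v = [2, 5, 4])"
    proof (intro inner_block[where t = "n - 1"])
      show "set (m # v) = {2..n - 2}" using sv unfolding v .
    qed (use dist fm 3 large in auto)
    then have False using large by linarith
    then show ?thesis ..
  qed
qed

end

section \<open>Realisation of the listed words\<close>

text \<open>
  With \<open>s = a + b\<close> and \<open>p = (s + 1) div 2\<close> this map runs through \<open>zigzag a b\<close> and leaves it from the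
  last entry \<open>p\<close> towards \<open>M\<close>.
\<close>

definition block_map :: "nat \<Rightarrow> nat \<Rightarrow> nat \<Rightarrow> nat \<Rightarrow> nat" where
  "block_map s p M x = (if x < p then s - x else if x = p then M else s + 1 - x)"

text \<open>Both branches decrease, and arguments on different sides of \<open>p\<close> differ by
  at least two, which outweighs the jump from \<open>s\<close> to \<open>s + 1\<close>. The bound
  \<open>y \<le> s\<close> prevents truncation.\<close>

lemma block_map_less:
  "x < y \<Longrightarrow> y \<le> s \<Longrightarrow> block_map s p M x < block_map s p M y \<Longrightarrow> x = p \<or> y = p"
  by (auto simp: block_map_def split: if_splits)

lemma chain_zigzag_block_map:
  assumes "s = a + b" "p = (s + 1) div 2" "\<And>x. x \<in> {a..b} \<Longrightarrow> f x = block_map s p M x"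
  shows "chain f (zigzag a b) \<and> (a \<le> b \<longrightarrow> f (last (zigzag a b)) = M)"
proof
  show "chain f (zigzag a b)"
    by (rule chain_zigzag) (simp_all add: assms block_map_def)
  show "a \<le> b \<longrightarrow> f (last (zigzag a b)) = M"
  proof
    assume "a \<le> b"
    then have "p \<in> {a..b}" unfolding assms(1,2) by auto
    then show "f (last (zigzag a b)) = M" using \<open>a \<le> b\<close> assms by (simp add: last_zigzag block_map_def)
  qed
qed

lemma good_wordsI:
  assumes "distinct w" "set w = {1..n}" "hd w = 1" "chain f w" "f (last w) = 1"
    "avoids_231 w" "avoids_123 n f"
  shows "w \<in> good_words n"
  using assms unfolding good_words_def cycle_word_def by blast

lemma max_inside_good:
  assumes "2 \<le> j" "j \<le> n - 2" "8 \<le> n"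
  shows "zigzag 1 j @ n # zigzag (Suc j) (n - 1) \<in> good_words n"
proof -
  define p where "p = (j + 2) div 2"
  define q where "q = (n + j + 1) div 2"
  \<comment> \<open>Two block maps, with exits \<open>p\<close> and \<open>q\<close> to
    \<open>n\<close> and to 1. The second one also covers \<open>n\<close> itself: its upper branch
    gives \<open>n + j + 1 - n = Suc j\<close>.\<close>
  define f where "f x = (if x \<le> j then block_map (j + 1) p n x else block_map (n + j) q 1 x)" for x
  have jn: "j + 2 \<le> n" using assms by simp
  have pq: "1 \<le> p" "p \<le> j" "j < q" "q < n" using assms jn unfolding p_def q_def by auto
  have "chain f (zigzag 1 j) \<and> (1 \<le> j \<longrightarrow> f (last (zigzag 1 j)) = n)"
    by (rule chain_zigzag_block_map[where s = "j + 1" and p = p]) (auto simp: f_def p_def)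
  then have 1: "chain f (zigzag 1 j)" "f (last (zigzag 1 j)) = n" using assms by simp_all
  have "chain f (zigzag (Suc j) (n - 1)) \<and> (Suc j \<le> n - 1 \<longrightarrow> f (last (zigzag (Suc j) (n - 1))) = 1)"
    by (rule chain_zigzag_block_map[where s = "n + j" and p = q]) (use jn in \<open>auto simp: f_def q_def\<close>)
  moreover have "Suc j \<le> n - 1" using jn by simp
  ultimately have 2: "chain f (zigzag (Suc j) (n - 1))" "f (last (zigzag (Suc j) (n - 1))) = 1" by simp_all
  have 3: "f n = Suc j" using pq unfolding f_def by (simp add: block_map_def)
  have ne: "zigzag (Suc j) (n - 1) \<noteq> []" "zigzag 1 j \<noteq> []" using jn assms(1) by auto
  have set_split: "{1..n} = {1..j} \<union> insert n {Suc j..n - 1}" using jn by auto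
  show ?thesis
  proof (rule good_wordsI)
    show "chain f (zigzag 1 j @ n # zigzag (Suc j) (n - 1))"
      using 1 2 3 ne jn by (simp add: successively_append_iff successively_Cons)
    show "f (last (zigzag 1 j @ n # zigzag (Suc j) (n - 1))) = 1" using 2 ne by simp
    show "avoids_231 (zigzag 1 j @ n # zigzag (Suc j) (n - 1))"
    proof (rule avoids_231_append)
      have "\<forall>y\<in>set (zigzag (Suc j) (n - 1)). y \<le> n" by auto
      then show "avoids_231 (n # zigzag (Suc j) (n - 1))" by (simp only: avoids_231_Cons_max avoids_231_zigzag)
    qed (use jn in auto)
    show "avoids_123 n f"
      unfolding avoids_123_def
    proof (intro allI impI notI)
      fix x y z assume "1 \<le> x" "x < y" "y < z" "z \<le> n" "f x < f y" "f y < f z"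
      then show False using pq jn unfolding f_def block_map_def by (auto split: if_splits)
    qed
  qed (use set_split jn assms(1) in auto)
qed

lemma max_second_good:
  assumes "3 \<le> j" "j \<le> n - 2" "8 \<le> n"
  shows "1 # n # j # zigzag 2 (j - 1) @ (n - 1) # zigzag (Suc j) (n - 2) \<in> good_words n"
proof -
  define p where "p = (j + 2) div 2"
  define q where "q = (n + j) div 2"
  \<comment> \<open>The upper branches also serve the heads of the two blocks: \<open>j\<close> goes
    to 2, and \<open>n - 1\<close> goes to \<open>Suc j\<close> unless it is itself the exit
    \<open>q\<close>.\<close>
  define f where "f x = (if x = 1 then n else if x = n then j else
     if x \<le> j then block_map (j + 1) p (n - 1) x else block_map (n + j - 1) q 1 x)" for x
  have jn: "j + 2 \<le> n" using assms by simp
  have pq: "2 \<le> p" "p < j" "j < q" "q < n" "q = n - 1 \<longrightarrow> j = n - 2" using assms jn unfolding p_def q_def by auto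
  have "chain f (zigzag 2 (j - 1)) \<and> (2 \<le> j - 1 \<longrightarrow> f (last (zigzag 2 (j - 1))) = n - 1)"
    by (rule chain_zigzag_block_map[where s = "j + 1" and p = p]) (use jn assms in \<open>auto simp: f_def p_def\<close>)
  moreover have "2 \<le> j - 1" using assms by simp
  ultimately have 1: "chain f (zigzag 2 (j - 1))" "f (last (zigzag 2 (j - 1))) = n - 1" by simp_all
  have "chain f (zigzag (Suc j) (n - 2)) \<and> (Suc j \<le> n - 2 \<longrightarrow> f (last (zigzag (Suc j) (n - 2))) = 1)"
    by (rule chain_zigzag_block_map[where s = "n + j - 1" and p = q]) (use jn assms in \<open>auto simp: f_def q_def\<close>)
  then have 2: "chain f (zigzag (Suc j) (n - 2))" "Suc j \<le> n - 2 \<Longrightarrow> f (last (zigzag (Suc j) (n - 2))) = 1"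
    by simp_all
  have 3: "f 1 = n" "f n = j" "f j = 2" using pq assms jn unfolding f_def by (auto simp: block_map_def)
  \<comment> \<open>For \<open>j = n - 2\<close> the last zigzag is empty, \<open>q\<close> falls on
    \<open>n - 1\<close>, and the word ends there.\<close>
  have 4: "f (n - 1) = (if j = n - 2 then 1 else Suc j)"
  proof (cases "j = n - 2")
    case True
    then have "q = n - 1" using assms(3) unfolding q_def by auto
    then show ?thesis using True assms by (auto simp: f_def block_map_def)
  next
    case False
    then have "q < n - 1" using jn unfolding q_def by auto
    then show ?thesis using False assms by (auto simp: f_def block_map_def)
  qed
  have set_split: "{1..n} = insert 1 (insert n (insert j ({2..j - 1} \<union> insert (n - 1) {Suc j..n - 2})))"
    using jn assms(1) by auto
  have anti1: "f t = n - 1 \<or> f t' = n - 1 \<or> f t' < f t" if "2 \<le> t" "t < t'" "t' \<le> j" for t t'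
    using that jn by (auto simp: f_def block_map_def)
  have anti2: "f t = 1 \<or> f t' = 1 \<or> f t' < f t" if "j < t" "t < t'" "t' < n" for t t'
    using that assms(1) by (auto simp: f_def block_map_def)
  have range1: "f t = n - 1 \<or> 2 \<le> f t \<and> f t \<le> j" if "2 \<le> t" "t \<le> j" for t
    using that jn pq(1,2) by (auto simp: f_def block_map_def)
  have range2: "f t = 1 \<or> j < f t \<and> f t < n - 1" if "j < t" "t < n" for t
    using that assms(1) jn pq(3,4) by (auto simp: f_def block_map_def)
  show ?thesis
  proof (rule good_wordsI)
    show "chain f (1 # n # j # zigzag 2 (j - 1) @ (n - 1) # zigzag (Suc j) (n - 2))"
      using 1 2 3 4 jn assms(1) by (auto simp: successively_append_iff successively_Cons)
    show "f (last (1 # n # j # zigzag 2 (j - 1) @ (n - 1) # zigzag (Suc j) (n - 2))) = 1"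
      using 2 4 jn by (cases "j = n - 2") auto
    have "avoids_231 ((n - 1) # zigzag (Suc j) (n - 2))" by (subst avoids_231_Cons_max) auto
    moreover have "avoids_231 (j # zigzag 2 (j - 1))" by (subst avoids_231_Cons_max) auto
    ultimately have "avoids_231 ((j # zigzag 2 (j - 1)) @ ((n - 1) # zigzag (Suc j) (n - 2)))"
      using jn by (intro avoids_231_append) auto
    moreover have "\<forall>x\<in>set ((j # zigzag 2 (j - 1)) @ ((n - 1) # zigzag (Suc j) (n - 2))). x \<le> n" using jn by auto
    ultimately have "avoids_231 (n # (j # zigzag 2 (j - 1)) @ ((n - 1) # zigzag (Suc j) (n - 2)))"
      by (simp only: avoids_231_Cons_max)
    then show "avoids_231 (1 # n # j # zigzag 2 (j - 1) @ (n - 1) # zigzag (Suc j) (n - 2))"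
      using jn assms(1) by (subst avoids_231_Cons_min) auto
    show "avoids_123 n f"
      unfolding avoids_123_def
    proof (intro allI impI notI)
      fix x y z assume *: "1 \<le> x" "x < y" "y < z" "z \<le> n" "f x < f y" "f y < f z"
      have jn': "j < n - 1" "n - 1 < n" using jn by auto
      have y: "2 \<le> y" "y < n" and z: "2 \<le> z" "z = n \<or> z < n" using * by auto
      \<comment> \<open>Only \<open>f 1\<close> exceeds \<open>n - 1\<close>, so this exit value
        cannot be a middle value of a triple. Hence \<open>y\<close> is in the upper block, and
        \<open>z\<close> as well because \<open>f n = j\<close> is too small.\<close>
      have fy: "f y \<noteq> n - 1"
        using range1[of z] range2[of z] z 3(2) jn' *(6) by (cases "z \<le> j") auto
      have "f y < n"
        using range1[of y] range2[of y] y jn' by (cases "y \<le> j") auto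
      then have "x \<noteq> 1" using 3(1) *(5) by auto
      then have x: "2 \<le> x" "x < n" using * by auto
      have fx: "1 \<le> f x" "f x \<noteq> n - 1"
        using range1[of x] range2[of x] x jn' fy \<open>f y < n\<close> *(5) assms(1) by (cases "x \<le> j"; auto)+
      have "j < y" using anti1[of x y] x(1) *(2,5) fx(2) fy by (cases "y \<le> j") auto
      then have "j < f y" using range2[of y] y fx(1) *(5) by auto
      then have "z < n" using z(2) 3(2) *(6) by auto
      then show False using anti2[of y z] \<open>j < y\<close> \<open>j < f y\<close> *(3,6) assms(1) by auto
    qed
    show "set (1 # n # j # zigzag 2 (j - 1) @ (n - 1) # zigzag (Suc j) (n - 2)) = {1..n}"
      unfolding set_split by simp
  qed (use jn assms(1) in auto)
qed

lemma max_second_sporadic_good: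
  assumes "8 \<le> n"
  shows "1 # n # 3 # 2 # 4 # (n - 1) # zigzag 5 (n - 2) \<in> good_words n"
proof -
  define q where "q = (n + 4) div 2"
  \<comment> \<open>The sum \<open>n + 3\<close> belongs to \<open>zigzag 5 (n - 2)\<close>, and its
    upper branch sends \<open>n - 1\<close> to 5.\<close>
  define f where "f x = (if x = 1 then n else if x = 2 then 4 else if x = 3 then 2 else
     if x = 4 then n - 1 else if x = n then 3 else block_map (n + 3) q 1 x)" for x
  have q: "4 < q" "q < n - 1" using assms unfolding q_def by auto
  have "chain f (zigzag 5 (n - 2)) \<and> (5 \<le> n - 2 \<longrightarrow> f (last (zigzag 5 (n - 2))) = 1)"
    by (rule chain_zigzag_block_map[where s = "n + 3" and p = q]) (use assms in \<open>auto simp: f_def q_def\<close>)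
  moreover have "5 \<le> n - 2" using assms by simp
  ultimately have 1: "chain f (zigzag 5 (n - 2))" "f (last (zigzag 5 (n - 2))) = 1" by simp_all
  have 2: "f 1 = n" "f n = 3" "f 3 = 2" "f 2 = 4" "f 4 = n - 1" "f (n - 1) = 5"
    using q assms unfolding f_def by (auto simp: block_map_def)
  have set_split: "{1..n} = insert 1 (insert n (insert 3 (insert 2 (insert 4 (insert (n - 1) {5..n - 2})))))"
    using assms by auto
  have anti: "f t = 1 \<or> f t' = 1 \<or> f t' < f t" if "4 < t" "t < t'" "t' < n" for t t'
    using that by (auto simp: f_def block_map_def)
  have range: "f t = 1 \<or> 4 < f t \<and> f t < n - 1" if "4 < t" "t < n" for t
    using that q by (auto simp: f_def block_map_def)
  show ?thesis
  proof (rule good_wordsI)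
    show "chain f (1 # n # 3 # 2 # 4 # (n - 1) # zigzag 5 (n - 2))"
      using 1 2 assms by (auto simp: successively_Cons)
    show "f (last (1 # n # 3 # 2 # 4 # (n - 1) # zigzag 5 (n - 2))) = 1"
      using 1 assms by auto
    have "avoids_231 ((n - 1) # zigzag 5 (n - 2))" by (subst avoids_231_Cons_max) auto
    then have "avoids_231 (4 # (n - 1) # zigzag 5 (n - 2))" using assms by (subst avoids_231_Cons_min) auto
    then have "avoids_231 ([3, 2] @ (4 # (n - 1) # zigzag 5 (n - 2)))"
      using assms by (intro avoids_231_append) auto
    then have "avoids_231 (n # 3 # 2 # 4 # (n - 1) # zigzag 5 (n - 2))"
      using assms by (subst avoids_231_Cons_max) auto
    then show "avoids_231 (1 # n # 3 # 2 # 4 # (n - 1) # zigzag 5 (n - 2))"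
      using assms by (subst avoids_231_Cons_min) auto
    show "avoids_123 n f"
      unfolding avoids_123_def
    proof (intro allI impI notI)
      fix x y z assume *: "1 \<le> x" "x < y" "y < z" "z \<le> n" "f x < f y" "f y < f z"
      have val: "t = 1 \<and> f t = n \<or> t = 2 \<and> f t = 4 \<or> t = 3 \<and> f t = 2 \<or>
          t = 4 \<and> f t = n - 1 \<or> 4 < t \<and> t < n \<and> 1 \<le> f t \<and> f t < n - 1 \<or> t = n \<and> f t = 3"
        if "1 \<le> t" "t \<le> n" for t
      proof -
        have "t = 1 \<or> t = 2 \<or> t = 3 \<or> t = 4 \<or> 4 < t \<and> t < n \<or> t = n" using that by presburger
        then consider "t = 1" | "t = 2" | "t = 3" | "t = 4" | "4 < t \<and> t < n" | "t = n" by blast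
        then show ?thesis
        proof cases
          case 5
          then have "f t = 1 \<or> 4 < f t \<and> f t < n - 1" using range by blast
          then have "1 \<le> f t \<and> f t < n - 1" using assms by auto
          then show ?thesis using 5 by blast
        qed (simp_all only: 2, simp_all)
      qed
      have n: "4 < n - 1" "n - 1 < n" using assms by auto
      have xyz: "1 \<le> y" "y \<le> n" "1 \<le> z" "x \<le> n" using * by auto
      have "f z \<le> n - 1" using val[OF xyz(3) *(4)] n *(1-3) by auto
      \<comment> \<open>The arguments 1 and 4 carry the two largest values, so neither can be
        followed by enough larger ones. This pushes \<open>y\<close> and \<open>z\<close> into the
        block above 4, where \<open>f\<close> decreases apart from the exit to 1.\<close>
      then have "y \<noteq> 4" "x \<noteq> 1" "x \<noteq> 4" using 2 *(5,6) n by auto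
      have "4 < y"
        using val[OF xyz(1,2)] val[OF *(1) xyz(4)] *(1-5) \<open>y \<noteq> 4\<close> \<open>x \<noteq> 1\<close> n by auto
      have "1 < f y" using *(5) val[OF *(1) xyz(4)] n by auto
      then have "4 < f y" using range[of y] \<open>4 < y\<close> *(3,4) by auto
      then have "z < n" using *(4,6) 2(2) by (cases "z = n") auto
      then show False using anti[of y z] \<open>4 < y\<close> \<open>4 < f y\<close> *(3,6) by auto
    qed
    show "set (1 # n # 3 # 2 # 4 # (n - 1) # zigzag 5 (n - 2)) = {1..n}"
      unfolding set_split by simp
  qed (use assms in auto)
qed

lemma max_last_sporadic_good:
  assumes "8 \<le> n"
  shows "1 # (n - 1) # (n - 2) # zigzag 2 (n - 3) @ [n] \<in> good_words n"
proof -
  define p where "p = n div 2"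
  \<comment> \<open>The sum \<open>n - 1\<close> belongs to \<open>zigzag 2 (n - 3)\<close>, with
    midpoint \<open>n div 2\<close>; its upper branch sends \<open>n - 2\<close> to 2.\<close>
  define f where "f x = (if x = 1 then n - 1 else if x = n then 1 else if x = n - 1 then n - 2
     else block_map (n - 1) p n x)" for x
  have p: "2 < p" "p < n - 2" using assms unfolding p_def by auto
  have "chain f (zigzag 2 (n - 3)) \<and> (2 \<le> n - 3 \<longrightarrow> f (last (zigzag 2 (n - 3))) = n)"
    by (rule chain_zigzag_block_map[where s = "n - 1" and p = p]) (use assms in \<open>auto simp: f_def p_def\<close>)
  moreover have "2 \<le> n - 3" using assms by simp
  ultimately have 1: "chain f (zigzag 2 (n - 3))" "f (last (zigzag 2 (n - 3))) = n" by simp_all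
  have 2: "f 1 = n - 1" "f n = 1" "f (n - 1) = n - 2" "f (n - 2) = 2"
    using p assms unfolding f_def by (auto simp: block_map_def)
  have set_split: "{1..n} = insert 1 (insert (n - 1) (insert (n - 2) ({2..n - 3} \<union> {n})))"
    using assms by auto
  show ?thesis
  proof (rule good_wordsI)
    show "chain f (1 # (n - 1) # (n - 2) # zigzag 2 (n - 3) @ [n])"
      using 1 2 assms by (auto simp: successively_append_iff successively_Cons)
    show "f (last (1 # (n - 1) # (n - 2) # zigzag 2 (n - 3) @ [n])) = 1"
      using 2 by simp
    have "avoids_231 ((n - 2) # zigzag 2 (n - 3))" by (subst avoids_231_Cons_max) auto
    then have "avoids_231 ((n - 1) # (n - 2) # zigzag 2 (n - 3))" using assms by (subst avoids_231_Cons_max) auto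
    then have "avoids_231 (((n - 1) # (n - 2) # zigzag 2 (n - 3)) @ [n])"
      using assms by (intro avoids_231_append) auto
    moreover have "\<forall>y\<in>set ((n - 1) # (n - 2) # zigzag 2 (n - 3) @ [n]). 1 \<le> y" using assms by auto
    ultimately show "avoids_231 (1 # (n - 1) # (n - 2) # zigzag 2 (n - 3) @ [n])"
      by (simp only: avoids_231_Cons_min append_Cons)
    show "avoids_123 n f"
      unfolding avoids_123_def
    proof (intro allI impI notI)
      fix x y z assume "1 \<le> x" "x < y" "y < z" "z \<le> n" "f x < f y" "f y < f z"
      have le: "f t \<le> n" for t using assms p by (auto simp: f_def block_map_def)
      have fp: "f p = n" using p by (auto simp: f_def block_map_def)
      \<comment> \<open>The exit \<open>p\<close> has the largest value \<open>n\<close>; with 1 and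
        \<open>n\<close> excluded as well, \<open>x\<close> and \<open>y\<close> lie where
        \<open>f\<close> is one decreasing block map.\<close>
      have "x \<noteq> p" "y \<noteq> p" using fp le[of y] le[of z] \<open>f x < f y\<close> \<open>f y < f z\<close> by auto
      have "f y \<le> n - 2" if "y \<noteq> 1"
        using that \<open>y \<noteq> p\<close> assms p \<open>1 \<le> x\<close> \<open>x < y\<close> \<open>y < z\<close> \<open>z \<le> n\<close> by (auto simp: f_def block_map_def)
      then have "x \<noteq> 1" using 2(1) \<open>f x < f y\<close> \<open>x < y\<close> by auto
      have "z \<noteq> n" using 2(2) \<open>f x < f y\<close> \<open>f y < f z\<close> by auto
      then have "f x = block_map (n - 1) p n x" "f y = block_map (n - 1) p n y" "y \<le> n - 1"
        using \<open>1 \<le> x\<close> \<open>x \<noteq> 1\<close> \<open>x < y\<close> \<open>y < z\<close> \<open>z \<le> n\<close> by (auto simp: f_def)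
      then show False using block_map_less[of x y "n - 1" p n] \<open>x < y\<close> \<open>f x < f y\<close> \<open>x \<noteq> p\<close> \<open>y \<noteq> p\<close>
        by simp
    qed
    show "set (1 # (n - 1) # (n - 2) # zigzag 2 (n - 3) @ [n]) = {1..n}"
      unfolding set_split by simp
    have "n \<noteq> 1" "n - 1 \<noteq> 1" "n - 2 \<noteq> 1" "n - 1 \<noteq> n - 2" "n - 1 \<noteq> n" "n - 2 \<noteq> n"
      "\<not> n - 1 \<le> n - 3" "\<not> n - 2 \<le> n - 3" "\<not> n \<le> n - 3" using assms by auto
    then show "distinct (1 # (n - 1) # (n - 2) # zigzag 2 (n - 3) @ [n])" by simp
  qed simp
qed

section \<open>Reduction of the length by two\<close>

lemma avoids_231_nth_iff:
  "avoids_231 w \<longleftrightarrow> (\<forall>i j k. i < j \<longrightarrow> j < k \<longrightarrow> k < length w \<longrightarrow> w ! k < w ! i \<longrightarrow> \<not> w ! i < w ! j)"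
  unfolding avoids_231_def subseq_3_iff by blast

lemma avoids_231_map:
  assumes "\<And>x y. x < y \<longleftrightarrow> h x < h y"
  shows "avoids_231 (map h w) \<longleftrightarrow> avoids_231 w"
proof -
  have "map h w ! k < map h w ! i \<longleftrightarrow> w ! k < w ! i" "map h w ! i < map h w ! j \<longleftrightarrow> w ! i < w ! j"
    if "i < j" "j < k" "k < length w" for i j k
    using that by (simp_all add: assms[symmetric])
  then show ?thesis unfolding avoids_231_nth_iff length_map by blast
qed

text \<open>On positive arguments and for \<open>M \<ge> 2\<close>, the increasing enumeration of
  the positive numbers other than 1 and \<open>M\<close>; order patterns are therefore unaffected by
  it.\<close>

definition skip :: "nat \<Rightarrow> nat \<Rightarrow> nat" where
  "skip M x = (if x + 1 < M then x + 1 else x + 2)"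

lemma skip_less_iff [simp]: "skip M x < skip M y \<longleftrightarrow> x < y"
  unfolding skip_def by auto

lemma skip_eq_iff [simp]: "skip M x = skip M y \<longleftrightarrow> x = y"
  unfolding skip_def by auto

lemma skip_neq: "skip M x \<noteq> M"
  unfolding skip_def by auto

lemma skip_gt_1: "1 \<le> x \<Longrightarrow> 1 < skip M x"
  unfolding skip_def by auto

lemma skip_1: "2 < M \<Longrightarrow> skip M 1 = 2"
  unfolding skip_def by auto

lemma not_in_skip_image: "M \<notin> skip M ` A" "\<forall>x\<in>A. 1 \<le> x \<Longrightarrow> 1 \<notin> skip M ` A"
  by (metis imageE skip_neq) (metis imageE less_irrefl skip_gt_1)

lemma skip_image:
  assumes "2 < M" "M \<le> n"
  shows "insert 1 (insert M (skip M ` {1..n - 2})) = {1..n}"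
proof (intro equalityI subsetI)
  fix x assume "x \<in> insert 1 (insert M (skip M ` {1..n - 2}))"
  then show "x \<in> {1..n}" using assms by (auto simp: skip_def split: if_splits)
next
  fix x assume x: "x \<in> {1..n}"
  then have "1 \<le> x" by simp
  then consider "x = 1" | "x = M" | "1 < x" "x < M" | "M < x" by linarith
  then show "x \<in> insert 1 (insert M (skip M ` {1..n - 2}))"
  proof cases
    case 3
    then have "x = skip M (x - 1)" "x - 1 \<in> {1..n - 2}" using assms by (auto simp: skip_def)
    then show ?thesis by blast
  next
    case 4
    then have "x = skip M (x - 2)" "x - 2 \<in> {1..n - 2}" using assms x by (auto simp: skip_def)
    then show ?thesis by blast
  qed auto
qed

lemma cycle_word_range:
  assumes "cycle_word n f w" "x \<in> {1..n}"
  shows "f x \<in> {1..n}"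
proof -
  have w: "set w = {1..n}" "f (last w) = 1" "chain f w" "distinct w"
    using assms(1) by (auto simp: cycle_word_def)
  have x: "x \<in> set w" using w(1) assms(2) by simp
  then obtain a v where v: "w = a # v" by (cases w) auto
  have "f ` (set w - {last w}) = set v" using chain_image[of f a v] w(3,4) unfolding v by blast
  then have "f x \<in> set v \<or> x = last w" using x by blast
  moreover have "set v \<subseteq> {1..n}" using w(1) unfolding v by auto
  ultimately show ?thesis using w(2) assms(2) by auto
qed

text \<open>The two new arguments occur in no increasing triple: 1 has too large a value, and
  \<open>M\<close> has value 2 and at most \<open>n\<close> to its right. All other comparisons are
  the same for \<open>f\<close> and \<open>g\<close>.\<close>

lemma avoids_123_skip_iff:
  assumes n: "4 \<le> n" and M: "M = n \<or> M = n - 1 \<and> g (n - 2) = 1"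
    and f1: "f 1 = M" and fM: "f M = 2"
    and f: "\<And>x. x \<in> {1..n - 2} \<Longrightarrow> f (skip M x) = (if g x = 1 then 1 else skip M (g x))"
    and g: "\<And>x. x \<in> {1..n - 2} \<Longrightarrow> g x \<in> {1..n - 2}"
    and f_range: "\<And>x. x \<in> {1..n} \<Longrightarrow> f x \<in> {1..n}"
  shows "avoids_123 n f \<longleftrightarrow> avoids_123 (n - 2) g"
proof -
  have M2: "2 < M" "M \<le> n" "n - 1 \<le> M" using M n by auto
  have less: "f (skip M x) < f (skip M y) \<longleftrightarrow> g x < g y" if "x \<in> {1..n - 2}" "y \<in> {1..n - 2}" for x y
  proof -
    have "1 \<le> g x" "1 \<le> g y" using g that by auto
    then show ?thesis using f[OF that(1)] f[OF that(2)] skip_gt_1[of "g x" M] skip_gt_1[of "g y" M] by auto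
  qed
  have skip_mem: "skip M x \<in> {1..n}" if "x \<in> {1..n - 2}" for x
    using skip_image[OF M2(1,2)] that by blast
  have skip_cases: "x = 1 \<or> x = M \<or> (\<exists>x'\<in>{1..n - 2}. x = skip M x')" if "x \<in> {1..n}" for x
    using that unfolding skip_image[OF M2(1,2), symmetric] by blast
  show ?thesis
  proof
    assume "avoids_123 n f"
    show "avoids_123 (n - 2) g"
      unfolding avoids_123_def
    proof (intro allI impI notI)
      fix x y z assume *: "1 \<le> x" "x < y" "y < z" "z \<le> n - 2" "g x < g y" "g y < g z"
      then have mem: "x \<in> {1..n - 2}" "y \<in> {1..n - 2}" "z \<in> {1..n - 2}" by auto
      have "f (skip M x) < f (skip M y)" "f (skip M y) < f (skip M z)" using less mem * by auto
      moreover have "1 \<le> skip M x" "skip M z \<le> n" using skip_mem mem by auto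
      ultimately show False using \<open>avoids_123 n f\<close> *(2,3) unfolding avoids_123_def by (metis skip_less_iff)
    qed
  next
    assume g_avoids: "avoids_123 (n - 2) g"
    show "avoids_123 n f"
      unfolding avoids_123_def
    proof (intro allI impI notI)
      fix x y z assume *: "1 \<le> x" "x < y" "y < z" "z \<le> n" "f x < f y" "f y < f z"
      then have mem: "x \<in> {1..n}" "y \<in> {1..n}" "z \<in> {1..n}" by auto
      have pos: "1 \<le> f x" "f z \<le> n" using f_range[OF mem(1)] f_range[OF mem(3)] by auto
      have "x \<noteq> 1" using f1 M2 * pos by auto
      have "x \<noteq> M" using M2 *(2-4) by auto
      \<comment> \<open>With \<open>M\<close> in the middle the third argument is \<open>n\<close>,
        so \<open>M = n - 1\<close>; but then \<open>n\<close> is the argument that leads to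
        1.\<close>
      have "y \<noteq> M"
      proof
        assume "y = M"
        then have "M = n - 1" "g (n - 2) = 1" "z = n" using M * n by auto
        moreover have "skip M (n - 2) = n" using \<open>M = n - 1\<close> n unfolding skip_def by auto
        ultimately have "f z = 1" using f[of "n - 2"] n by auto
        then show False using *(5,6) by simp
      qed
      have "z \<noteq> M" using fM *(5,6) pos by auto
      have "y \<noteq> 1" "z \<noteq> 1" using * by auto
      obtain x' where x': "x' \<in> {1..n - 2}" "x = skip M x'" using skip_cases[OF mem(1)] \<open>x \<noteq> 1\<close> \<open>x \<noteq> M\<close> by blast
      obtain y' where y': "y' \<in> {1..n - 2}" "y = skip M y'" using skip_cases[OF mem(2)] \<open>y \<noteq> 1\<close> \<open>y \<noteq> M\<close> by blast
      obtain z' where z': "z' \<in> {1..n - 2}" "z = skip M z'" using skip_cases[OF mem(3)] \<open>z \<noteq> 1\<close> \<open>z \<noteq> M\<close> by blast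
      have "x' < y'" "y' < z'" "g x' < g y'" "g y' < g z'" using * x' y' z' less by auto
      moreover have "1 \<le> x'" "z' \<le> n - 2" using x' z' by auto
      ultimately show False using g_avoids unfolding avoids_123_def by blast
    qed
  qed
qed

definition unskip :: "nat \<Rightarrow> nat \<Rightarrow> nat" where
  "unskip M x = (if x < M then x - 1 else x - 2)"

lemma unskip_skip: "1 \<le> x \<Longrightarrow> unskip M (skip M x) = x"
  unfolding unskip_def skip_def by auto

text \<open>Removing the entries \<open>1\<close> and \<open>M\<close> from the front redirects to \<open>2\<close> the only arrow into \<open>1\<close>.\<close>

lemma good_words_skip_iff:
  assumes n: "4 \<le> n" and M: "M = n \<or> M = n - 1 \<and> last v = n - 2"
    and v: "distinct v" "set v = {1..n - 2}" "hd v = 1"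
  shows "1 # M # map (skip M) v \<in> good_words n \<longleftrightarrow> v \<in> good_words (n - 2)"
proof -
  let ?w = "1 # M # map (skip M) v"
  have M2: "2 < M" "M \<le> n" "n - 1 \<le> M" using M n by auto
  have ne: "v \<noteq> []" using v(2) n by auto
  have v_pos: "1 \<le> x" if "x \<in> set v" for x using that unfolding v(2) by simp
  have last_v: "last v \<in> set v" using ne by simp
  have hdv: "v = 1 # tl v" using v(3) ne by (metis list.collapse)
  then have tl_v: "1 \<notin> set (tl v)" using v(1) by (metis distinct.simps(2))
  have hd_skip: "hd (map (skip M) v) = 2" using ne v(3) skip_1[OF M2(1)] by (simp add: hd_map)
  have set_w: "set ?w = {1..n}" using skip_image[OF M2(1,2)] v(2) by simp
  have "1 \<notin> skip M ` set v" "M \<notin> skip M ` set v" using not_in_skip_image v_pos by blast+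
  moreover have "inj_on (skip M) (set v)" by (rule inj_onI) simp
  ultimately have dist_w: "distinct ?w" using M2 v(1) by (simp add: distinct_map)
  have av_iff: "avoids_231 ?w \<longleftrightarrow> avoids_231 v"
  proof -
    have "\<forall>y\<in>set (M # map (skip M) v). 1 \<le> y" using set_w by (metis atLeastAtMost_iff list.set_intros(2))
    then have "avoids_231 ?w \<longleftrightarrow> avoids_231 (M # map (skip M) v)" by (rule avoids_231_Cons_min)
    also have "\<dots> \<longleftrightarrow> avoids_231 (map (skip M) v)"
      using M
    proof
      assume "M = n"
      then have "\<forall>y\<in>set (map (skip M) v). y \<le> M" using set_w by (metis atLeastAtMost_iff list.set_intros(2))
      then show ?thesis by (rule avoids_231_Cons_max)
    next
      assume M': "M = n - 1 \<and> last v = n - 2"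
      \<comment> \<open>Now \<open>n\<close> stands last, where a largest entry can be appended
        freely, and \<open>M\<close> is the maximum of everything else.\<close>
      define u where "u = butlast v"
      have vu: "v = u @ [n - 2]" using M' ne unfolding u_def by (metis append_butlast_last_id)
      have "skip M (n - 2) = n" using M' n unfolding skip_def by auto
      then have eq: "map (skip M) v = map (skip M) u @ [n]" using vu by simp
      have u_le: "skip M x < M" if "x \<in> set u" for x
      proof -
        have "x \<in> set v" "x \<noteq> n - 2" using that v(1) unfolding vu by auto
        then show ?thesis using M' n unfolding v(2) skip_def by auto
      qed
      show ?thesis
      proof
        assume "avoids_231 (map (skip M) v)"
        then have "avoids_231 (map (skip M) u)" unfolding eq by (rule avoids_231_appendD)
        moreover have "\<forall>y\<in>set (map (skip M) u). y \<le> M" using u_le by (auto intro: less_imp_le)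
        ultimately have "avoids_231 (M # map (skip M) u)" by (simp only: avoids_231_Cons_max)
        moreover have "x < n" if "x \<in> set (M # map (skip M) u)" for x
        proof -
          have "M < n" using M' n by auto
          then show ?thesis using that u_le by fastforce
        qed
        ultimately have "avoids_231 ((M # map (skip M) u) @ [n])" by (intro avoids_231_append) auto
        then show "avoids_231 (M # map (skip M) v)" unfolding eq by simp
      qed (rule avoids_231_ConsD)
    qed
    also have "\<dots> \<longleftrightarrow> avoids_231 v" by (rule avoids_231_map) simp
    finally show ?thesis .
  qed
  show ?thesis
  proof
    assume "?w \<in> good_words n"
    then obtain f where f: "avoids_231 ?w" "cycle_word n f ?w" "avoids_123 n f"
      unfolding good_words_def by blast
    have ch: "chain f ?w" and last_f: "f (last ?w) = 1" using f(2) by (auto simp: cycle_word_def)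
    have f1: "f 1 = M" using ch by simp
    have fM: "f M = 2" and ch': "chain f (map (skip M) v)" using ch ne hd_skip by (auto simp: successively_Cons)
    \<comment> \<open>The arrow into 1 needs its own case, as \<open>unskip\<close> would send 1 to
      0.\<close>
    define g where "g x = (if f (skip M x) = 1 then 1 else unskip M (f (skip M x)))" for x
    have g_eq: "g x = y" if "f (skip M x) = skip M y" "1 \<le> y" for x y
      using that skip_gt_1[of y M] unskip_skip[of y M] unfolding g_def by simp
    have inj: "inj_on f {1..n}" using f(2) by (rule cycle_word_inj) simp
    \<comment> \<open>The values \<open>M\<close> and 2 are already taken at 1 and \<open>M\<close>,
      so by injectivity no remaining entry leads to them.\<close>
    have next_cases: "f (skip M x) = 1 \<or> (\<exists>y\<in>set v. y \<noteq> 1 \<and> f (skip M x) = skip M y)" if "x \<in> set v" for x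
    proof -
      have mem: "skip M x \<in> {1..n}" "1 \<in> {1..n}" "M \<in> {1..n}" using that set_w M2 by auto
      have "f (skip M x) \<in> set ?w" using cycle_word_range[OF f(2) mem(1)] set_w by simp
      moreover have "f (skip M x) \<noteq> M" "f (skip M x) \<noteq> 2"
        using inj_onD[OF inj _ mem(1,2)] inj_onD[OF inj _ mem(1,3)] f1 fM skip_neq skip_gt_1[of x M] v_pos[OF that]
        by fastforce+
      ultimately show ?thesis using skip_1[OF M2(1)] by auto
    qed
    have "successively (\<lambda>x y. f (skip M x) = skip M y) v" using ch' by (simp add: successively_map)
    then have "chain g v" by (rule successively_mono) (use g_eq v_pos in blast)
    moreover have g_last: "g (last v) = 1" using last_f ne unfolding g_def by (simp add: last_map)
    moreover have "avoids_123 (n - 2) g"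
    proof -
      have "f (skip M x) = (if g x = 1 then 1 else skip M (g x)) \<and> g x \<in> {1..n - 2}" if "x \<in> {1..n - 2}" for x
      proof -
        have "x \<in> set v" using that v(2) by simp
        from next_cases[OF this] show ?thesis
        proof
          assume "f (skip M x) = 1"
          then show ?thesis using n unfolding g_def by auto
        next
          assume "\<exists>y\<in>set v. y \<noteq> 1 \<and> f (skip M x) = skip M y"
          then obtain y where y: "y \<in> set v" "y \<noteq> 1" "f (skip M x) = skip M y" by blast
          then have "g x = y" using g_eq v_pos by blast
          then show ?thesis using y unfolding v(2) by simp
        qed
      qed
      moreover have "M = n \<or> M = n - 1 \<and> g (n - 2) = 1" using M g_last by auto
      ultimately have "avoids_123 n f \<longleftrightarrow> avoids_123 (n - 2) g"
        by (intro avoids_123_skip_iff[OF n _ f1 fM] cycle_word_range[OF f(2)]) blast+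
      then show ?thesis using f(3) by simp
    qed
    ultimately show "v \<in> good_words (n - 2)"
      using v f(1) av_iff unfolding good_words_def cycle_word_def by blast
  next
    assume "v \<in> good_words (n - 2)"
    then obtain g where g: "avoids_231 v" "cycle_word (n - 2) g v" "avoids_123 (n - 2) g"
      unfolding good_words_def by blast
    have ch: "chain g v" and g_last: "g (last v) = 1" using g(2) by (auto simp: cycle_word_def)
    define f where "f x = (if x = 1 then M else if x = M then 2
        else if g (unskip M x) = 1 then 1 else skip M (g (unskip M x)))" for x
    have f_skip: "f (skip M x) = (if g x = 1 then 1 else skip M (g x))" if "1 \<le> x" for x
      using unskip_skip[OF that, of M] skip_neq[of M x] skip_gt_1[OF that, of M] unfolding f_def by simp
    have f1: "f 1 = M" and fM: "f M = 2" using M2 by (auto simp: f_def)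
    \<comment> \<open>Since 1 is not an entry of the tail, \<open>g\<close> never reaches 1 inside
      the word, and the redirected arrow occurs only at the end.\<close>
    have "chain f (map (skip M) u)" if "chain g u" "\<forall>x\<in>set u. 1 \<le> x" "\<forall>x\<in>set (tl u). x \<noteq> 1" for u
      using that by (induction u rule: induct_list012) (auto simp: f_skip)
    then have "chain f (map (skip M) v)" using ch v_pos tl_v by metis
    then have chain_w: "chain f ?w" using ne hd_skip f1 fM by (simp add: successively_Cons)
    have "f (last ?w) = 1" using ne g_last v_pos[OF last_v] by (simp add: last_map f_skip)
    then have cycle: "cycle_word n f ?w" using chain_w dist_w set_w by (simp add: cycle_word_def)
    have "M = n \<or> M = n - 1 \<and> g (n - 2) = 1" using M g_last by auto
    then have "avoids_123 n f \<longleftrightarrow> avoids_123 (n - 2) g"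
    proof (rule avoids_123_skip_iff[OF n _ f1 fM])
      fix x assume "x \<in> {1..n - 2}"
      then show "f (skip M x) = (if g x = 1 then 1 else skip M (g x))" by (intro f_skip) simp
      show "g x \<in> {1..n - 2}" using g(2) \<open>x \<in> {1..n - 2}\<close> by (rule cycle_word_range)
    qed (rule cycle_word_range[OF cycle])
    then have "avoids_123 n f" using g(3) by simp
    then show "?w \<in> good_words n"
      using cycle av_iff g(1) unfolding good_words_def by blast
  qed
qed

text \<open>The third entry 2 is what makes the shortened, relabelled word start with 1
  again.\<close>

lemma good_words_removable:
  assumes "w \<in> good_words n" "4 \<le> n" and w: "w = 1 # M # 2 # r"
    and M: "M = n \<or> M = n - 1 \<and> last w = n"
  obtains v where "v \<in> good_words (n - 2)" "w = 1 # M # map (skip M) v" "M = n - 1 \<longrightarrow> last v = n - 2"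
proof
  define v where "v = map (unskip M) (2 # r)"
  have M2: "2 < M" "M \<le> n" using M assms(2) by auto
  have dist: "distinct w" and set_w: "set w = {1..n}"
    using assms(1) by (auto simp: good_words_def cycle_word_def)
  have skip_unskip: "skip M (unskip M x) = x" if "x \<in> set (2 # r)" for x
  proof -
    have "x \<in> {1..n}" "x \<noteq> 1" "x \<noteq> M" using that dist unfolding set_w[symmetric] w by auto
    then show ?thesis unfolding skip_def unskip_def by auto
  qed
  have map_v: "map (skip M) v = 2 # r"
    unfolding v_def map_map by (rule map_idI) (simp only: comp_apply skip_unskip)
  then show w_eq: "w = 1 # M # map (skip M) v" unfolding w by simp
  have "distinct (map (skip M) v)" using dist unfolding w_eq by simp
  then have 1: "distinct v" by (simp add: distinct_map)
  have 2: "hd v = 1" unfolding v_def using M2 by (simp add: unskip_def)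
  have "set w = insert 1 (insert M (skip M ` set v))" unfolding w_eq by simp
  moreover have "1 \<notin> skip M ` set v" "M \<notin> skip M ` set v" using dist unfolding w_eq by simp_all
  ultimately have "skip M ` set v = {1..n} - {1, M}" unfolding set_w by blast
  also have "\<dots> = skip M ` {1..n - 2}"
  proof -
    have "1 \<notin> skip M ` {1..n - 2}" "M \<notin> skip M ` {1..n - 2}"
      by (intro not_in_skip_image; simp)+
    then show ?thesis using skip_image[OF M2] by blast
  qed
  finally have 3: "set v = {1..n - 2}" by (subst (asm) inj_image_eq_iff) (auto intro: injI)
  have last: "last v = n - 2" if "M = n - 1"
  proof -
    have "last (2 # r) = n" using M that assms(2) unfolding w by auto
    moreover have "last v = unskip M (last (2 # r))" unfolding v_def by (rule last_map) simp
    ultimately show ?thesis using that unfolding unskip_def by simp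
  qed
  then show "M = n - 1 \<longrightarrow> last v = n - 2" ..
  show "v \<in> good_words (n - 2)"
    using good_words_skip_iff[OF assms(2) _ 1 3 2, of M] M last assms(1) w_eq by blast
qed

section \<open>Enumeration for lengths 6 and 7\<close>

text \<open>Inserts the new maximum only where everything before it is smaller than everything after
  it. Positions start at 1 so that the entry 1 stays in front.\<close>

fun words_231 :: "nat \<Rightarrow> nat list list" where
  "words_231 0 = []"
| "words_231 (Suc 0) = [[1]]"
| "words_231 (Suc (Suc n)) =
     concat (map (\<lambda>v. map (\<lambda>i. take i v @ Suc (Suc n) # drop i v)
       (filter (\<lambda>i. \<forall>x\<in>set (take i v). \<forall>y\<in>set (drop i v). x < y) [1..<Suc (Suc n)])) (words_231 (Suc n)))"

fun free_123 :: "nat list \<Rightarrow> bool" where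
  "free_123 [] \<longleftrightarrow> True"
| "free_123 (x # xs) \<longleftrightarrow> sorted_wrt (\<ge>) (filter (\<lambda>y. x < y) xs) \<and> free_123 xs"

text \<open>Pairs the word with its rotation. The value is unspecified outside the word, which is
  harmless for words on \<open>{1..n}\<close>.\<close>

definition succ_in :: "nat list \<Rightarrow> nat \<Rightarrow> nat" where
  "succ_in w x = the (map_of (zip w (tl w @ [hd w])) x)"

definition good_list :: "nat \<Rightarrow> nat list list" where
  "good_list n = filter (\<lambda>w. free_123 (map (succ_in w) [1..<Suc n])) (words_231 n)"

text \<open>With \<open>remdups\<close> the lengths become cardinalities of the underlying sets, so
  the lists need not be shown free of repetitions. Words ending in their maximum are counted too,
  since their recursion has its own base.\<close>

lemma length_good_list:
  "length (remdups (good_list 6)) = 12"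
  "length (remdups (good_list 7)) = 20"
  "length (remdups (filter (\<lambda>w. last w = 6) (good_list 6))) = 3"
  "length (remdups (filter (\<lambda>w. last w = 7) (good_list 7))) = 4"
  by code_simp+

lemma sorted_wrt_filter_iff_subseq:
  "sorted_wrt P (filter Q xs) \<longleftrightarrow> (\<forall>a b. subseq [a, b] xs \<longrightarrow> Q a \<longrightarrow> Q b \<longrightarrow> P a b)"
proof (induction xs)
  case (Cons x xs)
  have sub: "subseq [a, b] (x # xs) \<longleftrightarrow> a = x \<and> b \<in> set xs \<or> subseq [a, b] xs" for a b
    using subseq_set[of "[a, b]" xs] by (auto simp: subseq_singleton_left)
  have "sorted_wrt P (filter Q (x # xs)) \<longleftrightarrow>
      (\<forall>b\<in>set xs. Q x \<longrightarrow> Q b \<longrightarrow> P x b) \<and> sorted_wrt P (filter Q xs)"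
    by (cases "Q x") (simp_all, blast)
  also have "\<dots> \<longleftrightarrow> (\<forall>a b. subseq [a, b] (x # xs) \<longrightarrow> Q a \<longrightarrow> Q b \<longrightarrow> P a b)"
    unfolding Cons.IH sub by blast
  finally show ?case .
qed simp

lemma free_123_iff_subseq:
  "free_123 w \<longleftrightarrow> (\<forall>x y z. subseq [x, y, z] w \<longrightarrow> x < y \<longrightarrow> \<not> y < z)"
proof (induction w)
  case (Cons v w)
  have 1: "subseq [x, y, z] (v # w) \<longleftrightarrow> x = v \<and> subseq [y, z] w \<or> subseq [x, y, z] w" for x y z
    using subseq_Cons'[of x "[y, z]" w] by auto
  have "free_123 (v # w) \<longleftrightarrow> (\<forall>a b. subseq [a, b] w \<longrightarrow> v < a \<longrightarrow> v < b \<longrightarrow> b \<le> a) \<and> free_123 w"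
    by (simp add: sorted_wrt_filter_iff_subseq)
  also have "(\<forall>a b. subseq [a, b] w \<longrightarrow> v < a \<longrightarrow> v < b \<longrightarrow> b \<le> a) \<longleftrightarrow>
      (\<forall>a b. subseq [a, b] w \<longrightarrow> v < a \<longrightarrow> \<not> a < b)"
  proof -
    have "(v < a \<longrightarrow> v < b \<longrightarrow> b \<le> a) \<longleftrightarrow> (v < a \<longrightarrow> \<not> a < b)" for a b by auto
    then show ?thesis by simp
  qed
  also have "(\<forall>a b. subseq [a, b] w \<longrightarrow> v < a \<longrightarrow> \<not> a < b) \<and> free_123 w \<longleftrightarrow>
      (\<forall>x y z. subseq [x, y, z] (v # w) \<longrightarrow> x < y \<longrightarrow> \<not> y < z)"
    unfolding Cons.IH 1 by blast
  finally show ?case .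
qed simp

lemma free_123_map_iff: "free_123 (map f [1..<Suc n]) \<longleftrightarrow> avoids_123 n f"
proof -
  have "contains_pattern (one_line n f) [1, 2, 3] \<longleftrightarrow>
      (\<exists>x y z. subseq [x, y, z] (one_line n f) \<and> x < y \<and> y < z)"
    unfolding contains_123_iff subseq_3_iff by blast
  then show ?thesis
    unfolding free_123_iff_subseq avoids_pattern_123[symmetric] one_line_def by blast
qed

lemma succ_in_cycle:
  assumes "distinct w" "set w = {1..n}" "hd w = 1" "w \<noteq> []"
  shows "cycle_word n (succ_in w) w"
proof -
  have nth: "succ_in w (w ! i) = (tl w @ [hd w]) ! i" if "i < length w" for i
    using that assms(1,4) unfolding succ_in_def by (subst map_of_zip_nth) auto
  have "chain (succ_in w) w"
    unfolding successively_conv_nth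
  proof (intro allI impI)
    fix i assume "Suc i < length w"
    moreover then have "i < length (tl w)" by simp
    ultimately show "succ_in w (w ! i) = w ! Suc i" using nth[of i] by (simp add: nth_append nth_tl)
  qed
  moreover have "succ_in w (last w) = 1"
    using nth[of "length w - 1"] assms(3,4) by (simp add: last_conv_nth nth_append)
  ultimately show ?thesis using assms by (simp add: cycle_word_def)
qed

definition words :: "nat \<Rightarrow> nat list set" where
  "words n = {w. distinct w \<and> set w = {1..n} \<and> hd w = 1 \<and> avoids_231 w}"

text \<open>Deleting the maximum inverts the insertion, and avoiding 231 forces the separation
  condition at the place where it stood.\<close>

lemma set_words_231: "1 \<le> n \<Longrightarrow> set (words_231 n) = words n"
proof (induction n rule: words_231.induct)
  case 2
  have "w = [1]" if "distinct w" "set w = {1::nat}" for w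
  proof -
    have "length w = Suc 0" using distinct_card[OF that(1)] that(2) by simp
    then obtain x where "w = [x]" by (auto simp: length_Suc_conv)
    then show ?thesis using that(2) by simp
  qed
  then have "words (Suc 0) = {[1]}" by (auto simp: words_def)
  then show ?case by simp
next
  case (3 n)
  let ?N = "Suc (Suc n)"
  have IH: "set (words_231 (Suc n)) = words (Suc n)" using 3 by simp
  have set_step: "w \<in> set (words_231 ?N) \<longleftrightarrow>
      (\<exists>v\<in>words (Suc n). \<exists>i. 1 \<le> i \<and> i < ?N \<and> (\<forall>x\<in>set (take i v). \<forall>y\<in>set (drop i v). x < y) \<and>
         w = take i v @ ?N # drop i v)" for w
    unfolding words_231.simps(3) set_concat set_map IH set_filter set_upt image_image
    by (simp only: UN_iff image_iff mem_Collect_eq atLeastLessThan_iff Bex_def) blast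
  show ?case
  proof (intro equalityI subsetI)
    fix w assume "w \<in> set (words_231 ?N)"
    then obtain v i where v: "v \<in> words (Suc n)" "1 \<le> i" "i < ?N" "w = take i v @ ?N # drop i v"
        and less: "\<forall>x\<in>set (take i v). \<forall>y\<in>set (drop i v). x < y"
      unfolding set_step by blast
    have vp: "distinct v" "set v = {1..Suc n}" "hd v = 1" "avoids_231 v" using v(1) by (auto simp: words_def)
    then have ne: "v \<noteq> []" by auto
    have tv: "take i v @ drop i v = v" by simp
    have "set (take i v) \<union> set (drop i v) = {1..Suc n}" using vp(2) by (metis set_append tv)
    moreover have "insert ?N {1..Suc n} = {1..?N}" by auto
    ultimately have "set w = {1..?N}" unfolding v(4) by (metis Un_insert_right list.simps(15) set_append)
    moreover have "distinct w"
    proof -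
      have "?N \<notin> set v" unfolding vp(2) by simp
      moreover have "set (take i v) \<inter> set (drop i v) = {}"
        using vp(1) by (rule set_take_disj_set_drop_if_distinct) simp
      ultimately show ?thesis using vp(1) unfolding v(4) by (auto dest: in_set_takeD in_set_dropD)
    qed
    moreover have "hd w = 1" using vp(3) v(2) ne unfolding v(4) by (cases v; cases i) auto
    moreover have "avoids_231 w"
      unfolding v(4)
    proof (rule avoids_231_append)
      show "avoids_231 (take i v)" using avoids_231_appendD(1)[of "take i v" "drop i v"] vp(4) by simp
      have "avoids_231 (drop i v)" using avoids_231_appendD(2)[of "take i v" "drop i v"] vp(4) by simp
      moreover have le: "x \<le> Suc n" if "x \<in> set v" for x using that unfolding vp(2) by simp
      then have "\<forall>y\<in>set (drop i v). y \<le> ?N" by (meson in_set_dropD le_SucI)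
      ultimately show "avoids_231 (?N # drop i v)" by (simp only: avoids_231_Cons_max)
      show "\<forall>x\<in>set (take i v). \<forall>y\<in>set (?N # drop i v). x < y"
        using less le by (auto dest: in_set_takeD simp: less_Suc_eq_le)
    qed
    ultimately show "w \<in> words ?N" by (simp add: words_def)
  next
    fix w assume "w \<in> words ?N"
    then have w: "distinct w" "set w = {1..?N}" "hd w = 1" "avoids_231 w" by (auto simp: words_def)
    then obtain u v where uv: "w = u @ ?N # v" by (metis atLeastAtMost_iff le_add1 order_refl plus_1_eq_Suc split_list)
    have ne: "u \<noteq> []" using w(3) unfolding uv by auto
    have "set (u @ v) = set w - {?N}" using w(1) unfolding uv by auto
    also have "\<dots> = {1..Suc n}" unfolding w(2) by auto
    finally have set_uv: "set (u @ v) = {1..Suc n}" .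
    have dist: "distinct (u @ v)" using w(1) unfolding uv by auto
    have "avoids_231 (u @ v)" using w(4) unfolding uv by (rule avoids_231_subseq) (simp add: subseq_append' list_emb_Cons)
    moreover have "hd (u @ v) = 1" using ne w(3) unfolding uv by simp
    ultimately have mem: "u @ v \<in> words (Suc n)" using set_uv dist by (simp add: words_def)
    have le: "x \<le> Suc n" if "x \<in> set (u @ v)" for x using that unfolding set_uv by simp
    have less: "\<forall>x\<in>set u. \<forall>y\<in>set v. x < y"
    proof (intro ballI)
      fix x y assume xy: "x \<in> set u" "y \<in> set v"
      have "\<forall>x\<in>set u. x < ?N" using le by (auto simp: less_Suc_eq_le)
      then have "x \<le> y" using avoids_231_max_split[of u ?N v x y] w(4) xy unfolding uv by blast
      moreover have "x \<noteq> y" using dist xy by auto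
      ultimately show "x < y" by simp
    qed
    have "length (u @ v) = Suc n" using dist set_uv by (metis card_atLeastAtMost diff_Suc_1 distinct_card)
    then have "1 \<le> length u" "length u < ?N" using ne by (cases u; simp)+
    moreover have "take (length u) (u @ v) = u" "drop (length u) (u @ v) = v" by simp_all
    ultimately show "w \<in> set (words_231 ?N)"
      unfolding set_step uv using mem less by (intro bexI[of _ "u @ v"] exI[of _ "length u"]) simp_all
  qed
qed simp

text \<open>Any witness agrees with \<open>succ_in w\<close> on \<open>{1..n}\<close>, so the
  existential quantifier becomes a computable test.\<close>

lemma set_good_list:
  assumes "1 \<le> n"
  shows "set (good_list n) = good_words n"
proof -
  have "(\<exists>f. cycle_word n f w \<and> avoids_123 n f) \<longleftrightarrow> avoids_123 n (succ_in w)" if "w \<in> words n" for w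
  proof -
    have "cycle_word n (succ_in w) w"
      using that assms by (intro succ_in_cycle) (auto simp: words_def)
    then show ?thesis using avoids_123_cong cycle_word_agree by (metis (no_types, lifting))
  qed
  moreover have "w \<in> words n" if "w \<in> good_words n" for w
    using that unfolding good_words_def words_def cycle_word_def by blast
  moreover have "avoids_231 w" if "w \<in> words n" for w using that by (simp add: words_def)
  ultimately have "good_words n = {w \<in> words n. avoids_123 n (succ_in w)}"
    unfolding good_words_def by blast
  then show ?thesis
    unfolding good_list_def set_filter set_words_231[OF assms] free_123_map_iff by simp
qed

lemma card_good_words_base:
  "card (good_words 6) = 12" "card (good_words 7) = 20"
  "card {w \<in> good_words 6. last w = 6} = 3" "card {w \<in> good_words 7. last w = 7} = 4"
  using length_good_list[unfolded length_remdups_card_conv set_filter] set_good_list[of 6] set_good_list[of 7]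
  by simp_all

section \<open>Counting\<close>

lemma finite_good_words: "finite (good_words n)"
proof -
  have "good_words n \<subseteq> {w. set w \<subseteq> {1..n} \<and> length w = n}"
    using distinct_card by (fastforce simp: good_words_def cycle_word_def)
  then show ?thesis using finite_lists_length_eq[of "{1..n}" n] finite_subset by blast
qed

lemma good_words_cases:
  assumes "w \<in> good_words n" "8 \<le> n"
  obtains x y v where "w = 1 # x # y # v" "distinct w" "set w = {1..n}"
    and "last w = n \<longrightarrow> x \<noteq> n \<and> y \<noteq> n" "x \<noteq> 1" "v \<noteq> []"
proof -
  have w: "distinct w" "set w = {1..n}" "hd w = 1" using assms(1) by (auto simp: good_words_def cycle_word_def)
  have "length w = n" using w distinct_card by fastforce
  then have "Suc (Suc (Suc (Suc 0))) \<le> length w" using assms(2) by simp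
  then obtain a x y z v where v: "w = a # x # y # z # v"
    by (auto simp: Suc_le_length_iff)
  then have "w = 1 # x # y # z # v" using w(3) by simp
  moreover have "last w = n \<longrightarrow> x \<noteq> n \<and> y \<noteq> n"
    using w(1) last_in_set[of "z # v"] unfolding v by auto
  moreover have "x \<noteq> 1" using w(1,3) unfolding v by auto
  ultimately show thesis using that[of x y "z # v"] w(1,2) by blast
qed

lemma good_cycleI:
  assumes "w \<in> good_words n" "8 \<le> n"
  obtains f where "good_cycle n f w"
  using assms unfolding good_words_def good_cycle_def by blast

lemma card_max_inside:
  assumes "8 \<le> n"
  shows "card {w \<in> good_words n. last w \<noteq> n \<and> w ! 1 \<noteq> n} = n - 3"
proof -
  let ?F = "\<lambda>j. zigzag 1 j @ n # zigzag (Suc j) (n - 1)"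
  \<comment> \<open>The second entry of a zigzag is its maximum; reading off \<open>j\<close> there
    gives injectivity.\<close>
  have nth: "?F j ! 1 = j" if "j \<in> {2..n - 2}" for j using that by (simp add: zigzag_Cons)
  have "{w \<in> good_words n. last w \<noteq> n \<and> w ! 1 \<noteq> n} = ?F ` {2..n - 2}"
  proof (intro equalityI subsetI)
    fix w assume w: "w \<in> {w \<in> good_words n. last w \<noteq> n \<and> w ! 1 \<noteq> n}"
    then have gw: "w \<in> good_words n" by simp
    obtain x y v where v: "w = 1 # x # y # v" "set w = {1..n}" "x \<noteq> 1"
      using good_words_cases[OF gw assms] by metis
    obtain f where "good_cycle n f w" using good_cycleI[OF gw assms] .
    then interpret good_cycle n f w .
    have "n \<in> set w" unfolding v(2) using assms by simp
    then have "n \<in> set (y # v)" using w assms unfolding v(1) by auto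
    then obtain s t where st: "y # v = s @ n # t" by (metis split_list)
    then have eq: "w = 1 # (x # s) @ n # t" unfolding v(1) by simp
    have "t \<noteq> []" using w unfolding eq by auto
    then obtain j where "2 \<le> j" "j \<le> n - 2" "w = ?F j" using max_inside[OF eq] by auto
    then show "w \<in> ?F ` {2..n - 2}" by auto
  next
    fix w assume "w \<in> ?F ` {2..n - 2}"
    then obtain j where j: "2 \<le> j" "j \<le> n - 2" "w = ?F j" by auto
    have "zigzag (Suc j) (n - 1) \<noteq> []" using j assms by auto
    then have "last w = last (zigzag (Suc j) (n - 1))" "last (zigzag (Suc j) (n - 1)) \<in> {Suc j..n - 1}"
      using last_in_set[of "zigzag (Suc j) (n - 1)"] unfolding j(3) by auto
    then have "last w \<noteq> n" using assms by auto
    moreover have "w ! 1 \<noteq> n" using nth[of j] j assms by auto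
    moreover have "w \<in> good_words n" unfolding j(3) by (rule max_inside_good[OF j(1,2) assms])
    ultimately show "w \<in> {w \<in> good_words n. last w \<noteq> n \<and> w ! 1 \<noteq> n}" by simp
  qed
  moreover have "inj_on ?F {2..n - 2}" by (rule inj_onI) (metis nth)
  ultimately show ?thesis using assms by (simp add: card_image)
qed

lemma card_max_second:
  assumes "8 \<le> n"
  shows "card {w \<in> good_words n. w ! 1 = n \<and> w ! 2 \<noteq> 2} = n - 3"
proof -
  let ?F = "\<lambda>j. 1 # n # j # zigzag 2 (j - 1) @ (n - 1) # zigzag (Suc j) (n - 2)"
  let ?s = "1 # n # 3 # 2 # 4 # (n - 1) # zigzag 5 (n - 2)"
  have "{w \<in> good_words n. w ! 1 = n \<and> w ! 2 \<noteq> 2} = insert ?s (?F ` {3..n - 2})"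
  proof (intro equalityI subsetI)
    fix w assume w: "w \<in> {w \<in> good_words n. w ! 1 = n \<and> w ! 2 \<noteq> 2}"
    then have gw: "w \<in> good_words n" by simp
    obtain x y v where v: "w = 1 # x # y # v" using good_words_cases[OF gw assms] by metis
    obtain f where "good_cycle n f w" using good_cycleI[OF gw assms] .
    then interpret good_cycle n f w .
    have "w = 1 # n # y # v" "y \<noteq> 2" using w unfolding v by auto
    from max_second[OF this] show "w \<in> insert ?s (?F ` {3..n - 2})" by auto
  next
    fix w assume "w \<in> insert ?s (?F ` {3..n - 2})"
    then show "w \<in> {w \<in> good_words n. w ! 1 = n \<and> w ! 2 \<noteq> 2}"
      using max_second_good[OF _ _ assms] max_second_sporadic_good[OF assms] by auto
  qed
  moreover have "inj_on ?F {3..n - 2}" by (rule inj_onI) simp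
  \<comment> \<open>The third entry would force \<open>j = 3\<close>, and then the fifth entry would
    have to be both 4 and \<open>n - 1\<close>. So there are \<open>n - 4\<close> regular words and
    one more.\<close>
  moreover have "?s \<notin> ?F ` {3..n - 2}"
  proof
    assume "?s \<in> ?F ` {3..n - 2}"
    then have "?s = ?F 3" by auto
    then have "n - 1 = 4" by simp
    then show False using assms by auto
  qed
  ultimately show ?thesis using assms by (simp add: card_image)
qed

lemma inj_skip_words: "inj_on (\<lambda>v. 1 # M # map (skip M) v) X"
proof (rule inj_onI)
  fix u v assume "1 # M # map (skip M) u = 1 # M # map (skip M) v"
  then have "map (skip M) u = map (skip M) v" by simp
  moreover have "inj (skip M)" by (rule injI) simp
  ultimately show "u = v" by (simp add: inj_map_eq_map)
qed

lemma good_words_props: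
  assumes "v \<in> good_words n" "1 \<le> n"
  shows "distinct v" "set v = {1..n}" "hd v = 1" "v \<noteq> []"
  using assms by (auto simp: good_words_def cycle_word_def)

lemma skip_hd:
  assumes "v \<in> good_words n" "1 \<le> n" "2 < M"
  shows "map (skip M) v = 2 # map (skip M) (tl v)"
  using good_words_props(3,4)[OF assms(1,2)] skip_1[OF assms(3)] by (cases v) auto

lemma card_removable:
  assumes "8 \<le> n"
  shows "card {w \<in> good_words n. w ! 1 = n \<and> w ! 2 = 2} = card (good_words (n - 2))"
proof -
  let ?F = "\<lambda>v. 1 # n # map (skip n) v"
  have n: "4 \<le> n" "1 \<le> n - 2" "2 < n" using assms by auto
  have "{w \<in> good_words n. w ! 1 = n \<and> w ! 2 = 2} = ?F ` good_words (n - 2)"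
  proof (intro equalityI subsetI)
    fix w assume w: "w \<in> {w \<in> good_words n. w ! 1 = n \<and> w ! 2 = 2}"
    then have gw: "w \<in> good_words n" by simp
    obtain x y v where v: "w = 1 # x # y # v" using good_words_cases[OF gw assms] by metis
    then have "w = 1 # n # 2 # v" using w by auto
    from good_words_removable[OF gw n(1) this] show "w \<in> ?F ` good_words (n - 2)" by blast
  next
    fix w assume "w \<in> ?F ` good_words (n - 2)"
    then obtain v where v: "v \<in> good_words (n - 2)" "w = ?F v" by blast
    have "w \<in> good_words n"
      unfolding v(2) using good_words_skip_iff[OF n(1) _ good_words_props(1-3)[OF v(1) n(2)]] v(1) by blast
    moreover have "w ! 1 = n \<and> w ! 2 = 2" unfolding v(2) skip_hd[OF v(1) n(2,3)] by simp
    ultimately show "w \<in> {w \<in> good_words n. w ! 1 = n \<and> w ! 2 = 2}" by blast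
  qed
  then show ?thesis using card_image[OF inj_skip_words] by metis
qed

lemma card_max_last:
  assumes "8 \<le> n"
  shows "card {w \<in> good_words n. last w = n} = card {w \<in> good_words (n - 2). last w = n - 2} + 1"
proof -
  let ?F = "\<lambda>v. 1 # (n - 1) # map (skip (n - 1)) v"
  let ?s = "1 # (n - 1) # (n - 2) # zigzag 2 (n - 3) @ [n]"
  let ?X = "{w \<in> good_words (n - 2). last w = n - 2}"
  have n: "4 \<le> n" "1 \<le> n - 2" "2 < n - 1" using assms by auto
  have "{w \<in> good_words n. last w = n} = insert ?s (?F ` ?X)"
  proof (intro equalityI subsetI)
    fix w assume w: "w \<in> {w \<in> good_words n. last w = n}"
    then have gw: "w \<in> good_words n" by simp
    obtain x y v where v: "w = 1 # x # y # v" "v \<noteq> []" using good_words_cases[OF gw assms] by metis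
    obtain f where "good_cycle n f w" using good_cycleI[OF gw assms] .
    then interpret good_cycle n f w .
    have "w = 1 # (x # y # butlast v) @ [n]" using w v by auto
    from max_last[OF this] show "w \<in> insert ?s (?F ` ?X)"
    proof
      assume "\<exists>v. w = 1 # (n - 1) # 2 # v"
      then obtain r where r: "w = 1 # (n - 1) # 2 # r" by blast
      obtain u where "u \<in> good_words (n - 2)" "w = ?F u" "last u = n - 2"
        by (rule good_words_removable[OF gw n(1) r]) (use w in auto)
      then show ?thesis by blast
    qed simp
  next
    fix w assume "w \<in> insert ?s (?F ` ?X)"
    then show "w \<in> {w \<in> good_words n. last w = n}"
    proof
      assume "w = ?s"
      then show ?thesis using max_last_sporadic_good[OF assms] by simp
    next
      assume "w \<in> ?F ` ?X"
      then obtain v where v: "v \<in> good_words (n - 2)" "last v = n - 2" "w = ?F v" by blast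
      note props = good_words_props[OF v(1) n(2)]
      have "w \<in> good_words n"
        unfolding v(3) using good_words_skip_iff[OF n(1) _ props(1-3), of "n - 1"] v(1,2) by blast
      moreover have "last w = skip (n - 1) (n - 2)" unfolding v(3) using props(4) v(2) by (simp add: last_map)
      moreover have "skip (n - 1) (n - 2) = n" using assms unfolding skip_def by auto
      ultimately show ?thesis by simp
    qed
  qed
  moreover have "?s \<notin> ?F ` ?X"
  proof
    assume "?s \<in> ?F ` ?X"
    then obtain v where "?s = ?F v" "v \<in> ?X" by (rule imageE)
    then have v: "v \<in> good_words (n - 2)" "?s = ?F v" by simp_all
    \<comment> \<open>The third entry separates the sporadic word, which has \<open>n - 2\<close>
      there, from the lengthened ones.\<close>
    have "?F v ! 2 = 2" unfolding skip_hd[OF v(1) n(2,3)] by simp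
    moreover have "?s ! 2 = n - 2" by simp
    ultimately have "n - 2 = 2" using v(2) by argo
    then show False using assms by auto
  qed
  moreover have "finite ?X" using finite_good_words by simp
  ultimately show ?thesis using card_image[OF inj_skip_words[of "n - 1" ?X]] by simp
qed

text \<open>Each shortening by two loses one word; the start values 3 and 4 at lengths 6 and 7 make
  this half the length, rounded up.\<close>

lemma card_max_last_closed:
  assumes "6 \<le> n"
  shows "card {w \<in> good_words n. last w = n} = (n + 1) div 2"
  using assms
proof (induction n rule: less_induct)
  case (less n)
  consider "n = 6" | "n = 7" | "8 \<le> n" using less.prems by linarith
  then show ?case
  proof cases
    case 3
    then have "card {w \<in> good_words (n - 2). last w = n - 2} = (n - 2 + 1) div 2"
      by (intro less.IH) auto
    then show ?thesis using card_max_last[OF 3] 3 by auto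
  qed (simp_all add: card_good_words_base)
qed

lemma card_good_words_rec:
  assumes "8 \<le> n"
  shows "card (good_words n) = card (good_words (n - 2)) + 2 * (n - 3) + (n + 1) div 2"
proof -
  let ?A = "{w \<in> good_words n. last w \<noteq> n \<and> w ! 1 \<noteq> n}"
  let ?B = "{w \<in> good_words n. w ! 1 = n \<and> w ! 2 \<noteq> 2}"
  let ?Y = "{w \<in> good_words n. w ! 1 = n \<and> w ! 2 = 2}"
  let ?C = "{w \<in> good_words n. last w = n}"
  have fin: "finite ?A" "finite ?B" "finite ?Y" "finite ?C" using finite_good_words by simp_all
  \<comment> \<open>Needed for disjointness: a word ending in \<open>n\<close> cannot have
    \<open>n\<close> in second place as well.\<close>
  have excl: "w ! 1 \<noteq> n" if "w \<in> good_words n" "last w = n" for w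
    using good_words_cases[OF that(1) assms] that(2) by (metis One_nat_def nth_Cons_0 nth_Cons_Suc)
  have "good_words n = ?A \<union> (?B \<union> (?Y \<union> ?C))" by blast
  then have "card (good_words n) = card (?A \<union> (?B \<union> (?Y \<union> ?C)))" by (rule arg_cong)
  also have "card (?A \<union> (?B \<union> (?Y \<union> ?C))) = card ?A + (card ?B + (card ?Y + card ?C))"
  proof -
    have "?A \<inter> (?B \<union> (?Y \<union> ?C)) = {}" "?B \<inter> (?Y \<union> ?C) = {}" "?Y \<inter> ?C = {}" using excl by blast+
    then show ?thesis using fin by (simp add: card_Un_disjoint)
  qed
  also have "\<dots> = (n - 3) + ((n - 3) + (card (good_words (n - 2)) + (n + 1) div 2))"
    using assms
    by (simp only: card_max_inside card_max_second card_removable card_max_last_closed order.trans[of 6 8 n])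
  finally show ?thesis by simp
qed

lemma card_good_words_closed:
  assumes "6 \<le> n"
  shows "int (card (good_words n)) =
    5 * int ((n - 1) div 2 choose 2) + (if even n then 2 * int n - 5 else int n - 2)"
  using assms
proof (induction n rule: less_induct)
  case (less n)
  consider "n = 6" | "n = 7" | "8 \<le> n" using less.prems by linarith
  then show ?case
  proof cases
    case 1
    then show ?thesis by (simp add: card_good_words_base choose_two)
  next
    case 2
    then show ?thesis by (simp add: card_good_words_base choose_two)
  next
    case 3
    have IH: "int (card (good_words (n - 2))) = 5 * int ((n - 2 - 1) div 2 choose 2) +
        (if even (n - 2) then 2 * int (n - 2) - 5 else int (n - 2) - 2)"
      using 3 by (intro less.IH) auto
    define m where "m = (n - 2 - 1) div 2"
    have m: "(n - 1) div 2 = Suc m" "m \<ge> 1" using 3 unfolding m_def by auto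
    have "Suc m choose 2 = m + (m choose 2)" by (simp add: numeral_2_eq_2)
    then have "int ((n - 1) div 2 choose 2) = int m + int (m choose 2)" unfolding m(1) by simp
    \<comment> \<open>In these terms the increment \<open>2 * (n - 3) + (n + 1) div 2\<close> is
      \<open>5 * m + 4\<close> for even and \<open>5 * m + 2\<close> for odd \<open>n\<close>: the
      binomial part grows by \<open>5 * m\<close>, the linear part by the remainder.\<close>
    moreover have "even n \<Longrightarrow> n = 2 * m + 4" "odd n \<Longrightarrow> n = 2 * m + 3"
      using 3 unfolding m_def by presburger+
    ultimately show ?thesis
      using card_good_words_rec[OF 3] IH 3 unfolding m_def[symmetric] by (cases "even n") auto
  qed
qed

theorem theorem4p5:
  defines "a \<equiv> \<lambda>n::nat. num_cyclic_avoiders n [1, 2, 3] [2, 3, 1]"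
  shows "(\<forall>n\<ge>8. int (a n) = int (a (n - 2)) + 2 * int n - 6 + \<lceil>real n / 2\<rceil>)
         \<and> a 6 = 12 \<and> a 7 = 20
         \<and> (\<forall>n\<ge>6. int (a n) = 5 * int (nat \<lfloor>(real n - 1) / 2\<rfloor> choose 2)
                              + (if even n then 2 * int n - 5 else int n - 2))"
proof -
  have a: "a n = card (good_words n)" if "1 \<le> n" for n
    unfolding a_def by (rule card_cyclic_avoiders[OF that])
  have ceil: "\<lceil>real n / 2\<rceil> = int ((n + 1) div 2)" for n
    by (cases "even n") (auto elim!: evenE oddE simp: ceiling_eq_iff)
  have floor: "nat \<lfloor>(real n - 1) / 2\<rfloor> = (n - 1) div 2" if "1 \<le> n" for n
  proof -
    have "(real n - 1) / 2 = real (n - 1) / real 2" using that by simp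
    then show ?thesis by (simp only: floor_divide_of_nat_eq nat_int)
  qed
  have "int (a n) = int (a (n - 2)) + 2 * int n - 6 + \<lceil>real n / 2\<rceil>" if "8 \<le> n" for n
    using card_good_words_rec[OF that] a[of n] a[of "n - 2"] that unfolding ceil by auto
  moreover have "a 6 = 12" "a 7 = 20" using a card_good_words_base by simp_all
  moreover have "int (a n) = 5 * int (nat \<lfloor>(real n - 1) / 2\<rfloor> choose 2)
      + (if even n then 2 * int n - 5 else int n - 2)" if "6 \<le> n" for n
    using card_good_words_closed[OF that] a[of n] floor[of n] that by simp
  ultimately show ?thesis by blast
qed

end
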